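(* Let $\Delta$ be a quasi-tree on $[n]$ of dimension $d-1$, and let $\ell$ be a nonnegative integer with $\ell\leq d-1$. Let $I\subset S=K[x_1,\ldots,x_n]$ ($K$ a field) be the ideal generated by all monomials $x_F=\prod_{i\in F}x_i$ where $F$ ranges over the $(\ell+1)$-element subsets of $[n]$ with $F\notin\Delta$ (i.e. $I$ is the facet ideal of $\overline{\mathrm{skel}_\Delta(\ell)}$). Then for every $k\geq 1$ the power $I^k$ has a linear resolution.
   Context: A simplicial complex on $[n]$ is a collection of subsets of $[n]$ containing all singletons and closed under taking subsets; facets are maximal faces, and $\langle F_1,\ldots,F_m\rangle$ denotes the complex with facets $F_1,\ldots,F_m$. A facet $F$ is a leaf if either it is the only facet, or there is a facet $G\neq F$ with $H\cap F\subseteq G\cap F$ for every facet $H\neq F$. $\Delta$ is a quasi-tree if its facets can be labeled $F_1,\ldots,F_m$ so that each $F_i$ is a leaf of $\langle F_1,\ldots,F_i\rangle$. The $\ell$-skeleton $\mathrm{skel}_\Delta(\ell)$ is the complex whose facets are the $\ell$-dimensional faces of $\Delta$; for a pure $(e-1)$-dimensional complex $\Gamma$, $\bar\Gamma$ is the complex generated by all $e$-subsets of $[n]$ not in $\Gamma$; the facet ideal of a complex is generated by $x_F$ for its facets $F$. A graded ideal generated in degree $q$ has a linear resolution if in its minimal graded free resolution the $i$-th free module is generated in degree $q+i$ for all $i$. *)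

theory Defs
  imports Main "HOL-Library.Poly_Mapping"
begin

section \<open>Simplicial complexes on a finite ground set (the type 'a plays the role of [n])\<close>

definition simplicial_complex :: "'a set set \<Rightarrow> bool" where
  "simplicial_complex \<Delta> \<longleftrightarrow> (\<forall>v. {v} \<in> \<Delta>) \<and> (\<forall>F\<in>\<Delta>. \<forall>G. G \<subseteq> F \<longrightarrow> G \<in> \<Delta>)"

definition facets :: "'a set set \<Rightarrow> 'a set set" where
  "facets \<Delta> = {F \<in> \<Delta>. \<forall>G\<in>\<Delta>. F \<subseteq> G \<longrightarrow> G = F}"

definition generated :: "'a set set \<Rightarrow> 'a set set" where
  "generated Fs = {G. \<exists>F\<in>Fs. G \<subseteq> F}"

definition is_leaf :: "'a set set \<Rightarrow> 'a set \<Rightarrow> bool" where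
  "is_leaf \<Delta> F \<longleftrightarrow> F \<in> facets \<Delta> \<and>
     (facets \<Delta> = {F} \<or>
      (\<exists>G\<in>facets \<Delta>. G \<noteq> F \<and> (\<forall>H\<in>facets \<Delta>. H \<noteq> F \<longrightarrow> H \<inter> F \<subseteq> G \<inter> F)))"

definition quasi_tree :: "'a set set \<Rightarrow> bool" where
  "quasi_tree \<Delta> \<longleftrightarrow> (\<exists>L. distinct L \<and> set L = facets \<Delta> \<and>
     (\<forall>i < length L. is_leaf (generated (set (take (Suc i) L))) (L ! i)))"

type_synonym ('a, 'k) mpoly = "('a \<Rightarrow>\<^sub>0 nat) \<Rightarrow>\<^sub>0 'k"

definition mon_deg :: "('a \<Rightarrow>\<^sub>0 nat) \<Rightarrow> nat" where
  "mon_deg m = (\<Sum>v\<in>Poly_Mapping.keys m. Poly_Mapping.lookup m v)"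

text \<open>Homogeneous of degree q (the zero polynomial is homogeneous of every degree).\<close>
definition homogeneous :: "nat \<Rightarrow> ('a, 'k::zero) mpoly \<Rightarrow> bool" where
  "homogeneous q p \<longleftrightarrow> (\<forall>m\<in>Poly_Mapping.keys p. mon_deg m = q)"

definition xmon :: "'a set \<Rightarrow> ('a, 'k::{zero,one}) mpoly" where
  "xmon F = Poly_Mapping.single (\<Sum>v\<in>F. Poly_Mapping.single v (1::nat)) 1"

definition ideal_gen :: "'r::comm_ring_1 set \<Rightarrow> 'r set" where
  "ideal_gen G = {p. \<exists>A c. finite A \<and> A \<subseteq> G \<and> p = (\<Sum>g\<in>A. c g * g)}"

definition ideal_pow :: "'r::comm_ring_1 set \<Rightarrow> nat \<Rightarrow> 'r set" where
  "ideal_pow I k = ideal_gen {\<Prod>i<k. f i | f. \<forall>i<k. f i \<in> I}"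

text \<open>Elements of the free module S^r: functions nat => S vanishing from index r on.\<close>
definition fvec :: "nat \<Rightarrow> (nat \<Rightarrow> 'r::zero) set" where
  "fvec r = {v. \<forall>j\<ge>r. v j = 0}"

definition mat_app :: "nat \<Rightarrow> nat \<Rightarrow> (nat \<Rightarrow> nat \<Rightarrow> 'r::comm_ring_1) \<Rightarrow> (nat \<Rightarrow> 'r) \<Rightarrow> nat \<Rightarrow> 'r" where
  "mat_app r c M v = (\<lambda>i. if i < r then (\<Sum>j<c. M i j * v j) else 0)"

text \<open>
  linear_resolution J q: there is a graded free resolution
    ... -> F_2 -D_2-> F_1 -D_1-> F_0 -eps-> J -> 0
  with F_i = S(-(q+i))^(b i), eps given by generators g_j homogeneous of degree q and
  all differentials D_i given by matrices of homogeneous linear forms (degree 0 maps).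
  Such a resolution is automatically minimal (all entries lie in the maximal homogeneous
  ideal), so this says exactly that the minimal graded free resolution of J has its
  i-th module generated in degree q+i.
\<close>
definition linear_resolution :: "('a, 'k::field) mpoly set \<Rightarrow> nat \<Rightarrow> bool" where
  "linear_resolution J q \<longleftrightarrow>
    (\<exists>(b::nat \<Rightarrow> nat) (g::nat \<Rightarrow> ('a,'k) mpoly) (D::nat \<Rightarrow> nat \<Rightarrow> nat \<Rightarrow> ('a,'k) mpoly).
       (\<forall>j < b 0. homogeneous q (g j)) \<and>
       (\<forall>i\<ge>1. \<forall>r < b (i - 1). \<forall>c < b i. homogeneous 1 (D i r c)) \<and>
       {(\<Sum>j < b 0. v j * g j) | v. True} = J \<and>
       {v \<in> fvec (b 0). (\<Sum>j < b 0. v j * g j) = 0} = mat_app (b 0) (b 1) (D 1) ` fvec (b 1) \<and>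
       (\<forall>i\<ge>1. {v \<in> fvec (b i). mat_app (b (i - 1)) (b i) (D i) v = (\<lambda>_. 0)}
                = mat_app (b i) (b (Suc i)) (D (Suc i)) ` fvec (b (Suc i))))"

definition has_linear_resolution :: "('a, 'k::field) mpoly set \<Rightarrow> bool" where
  "has_linear_resolution J \<longleftrightarrow> (\<exists>q. linear_resolution J q)"

end

theory Submission
  imports Defs "HOL-Library.Multiset" "HOL-Library.Product_Lexorder"
begin

text \<open>
  A quasi-tree is the clique complex of a chordal graph; list the vertices in a perfect elimination
  order. Put \<open>r = l + 1\<close>. A monomial of degree \<open>r k\<close> is a product of \<open>k\<close> squarefree monomials supported
  on non-cliques iff its exponents are at most \<open>k\<close> and it is divisible by a product of \<open>k\<close> non-edges.
  Order these monomials by the smallest multiset of \<open>k\<close> non-edges whose product divides them (multiset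
  extension of the lexicographic order on pairs), breaking ties by a generic linear weight. In this
  order the generators of \<open>I\<^sup>k\<close> have linear quotients: two multisets of non-edges are compared by
  alternating trails. Finally, linear quotients propagate from a sequence of vectors to a suitably
  ordered generating sequence of their syzygy module, so iterating syzygies yields a linear resolution.
\<close>

section \<open>Polynomials and ideals of variables\<close>

text \<open>A generator of the power factors into \<open>k\<close> non-faces in many ways, so no
  such factorization can label it. The least multiset of non-edges dividing it is canonical, and its
  minimality drives the exchange. A lighter multiset \<open>W'\<close> produced by a trail cannot
  divide \<open>m\<close>, and this forces the incoming variable to have a larger exponent in the
  competitor \<open>m'\<close> than in \<open>m\<close>. That comparison is needed twice: the
  incoming variable must divide the monomial that witnesses the colon relation, and its new exponent
  must stay within the bound \<open>k\<close>.

  The obstacle is that a replacement must not introduce large non-edges. Therefore only the largest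
  pair \<open>(a, b)\<close> in which the two multisets differ is attacked. Elimination is applied
  to a vertex preceding \<open>a\<close>, so that each new non-edge starts before \<open>a\<close>
  and is smaller than \<open>(a, b)\<close>.\<close>

abbreviation mvar :: "'a \<Rightarrow> ('a \<Rightarrow>\<^sub>0 nat)" where
  "mvar x \<equiv> Poly_Mapping.single x (Suc 0)"

abbreviation pvar :: "'a \<Rightarrow> ('a, 'k::field) mpoly" where
  "pvar x \<equiv> Poly_Mapping.single (mvar x) 1"

text \<open>Membership in the ideal generated by the variables of \<open>S\<close>, expressed
  through supports so that colon ideals can be tested one monomial at a time.\<close>

definition in_var_ideal :: "'a set \<Rightarrow> ('a, 'k::field) mpoly \<Rightarrow> bool" where
  "in_var_ideal S p \<longleftrightarrow> (\<forall>m\<in>Poly_Mapping.keys p. \<exists>x\<in>S. 0 < Poly_Mapping.lookup m x)"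

lemma poly_mapping_sum_single:
  "p = (\<Sum>m\<in>Poly_Mapping.keys p. Poly_Mapping.single m (Poly_Mapping.lookup p m))"
proof (rule poly_mapping_eqI)
  fix n
  have "Poly_Mapping.lookup (\<Sum>m\<in>Poly_Mapping.keys p. Poly_Mapping.single m (Poly_Mapping.lookup p m)) n
      = (\<Sum>m\<in>Poly_Mapping.keys p. if m = n then Poly_Mapping.lookup p m else 0)"
    by (simp add: lookup_sum lookup_single when_def)
  also have "\<dots> = Poly_Mapping.lookup p n"
    by (simp add: in_keys_iff)
  finally show "Poly_Mapping.lookup p n =
      Poly_Mapping.lookup (\<Sum>m\<in>Poly_Mapping.keys p. Poly_Mapping.single m (Poly_Mapping.lookup p m)) n"
    by simp
qed

text \<open>Shifting by \<open>n\<close> is injective on exponents, so multiplication by a monomial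
  causes no cancellation.\<close>

lemma lookup_times_single_add:
  fixes p :: "('a, 'k::field) mpoly"
  shows "Poly_Mapping.lookup (p * Poly_Mapping.single n 1) (m + n) = Poly_Mapping.lookup p m"
proof -
  have "p * Poly_Mapping.single n 1
      = (\<Sum>m\<in>Poly_Mapping.keys p. Poly_Mapping.single (m + n) (Poly_Mapping.lookup p m))"
    by (subst poly_mapping_sum_single[of p]) (simp add: sum_distrib_right mult_single)
  then have "Poly_Mapping.lookup (p * Poly_Mapping.single n 1) (m + n)
      = (\<Sum>m'\<in>Poly_Mapping.keys p. if m' = m then Poly_Mapping.lookup p m' else 0)"
    by (simp add: lookup_sum lookup_single when_def)
  then show ?thesis
    by (simp add: in_keys_iff)
qed

lemma poly_mapping_split:
  fixes p :: "'b \<Rightarrow>\<^sub>0 'c::ab_group_add"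
  obtains p1 p2 where "p = p1 + p2" "Poly_Mapping.keys p1 \<subseteq> {m. P m}"
    "Poly_Mapping.keys p2 \<subseteq> {m. \<not> P m}"
proof -
  define p1 where "p1 = Poly_Mapping.mapp (\<lambda>m c. c when P m) p"
  have l: "Poly_Mapping.lookup p1 m = (Poly_Mapping.lookup p m when P m)" for m
    by (simp add: p1_def lookup_mapp when_def in_keys_iff)
  show ?thesis
    by (rule that[of p1 "p - p1"]) (auto simp: in_keys_iff l lookup_minus when_def split: if_splits)
qed

section \<open>Degrees and homogeneous polynomials\<close>

lemma mon_deg_eq_sum_UNIV:
  fixes m :: "'a::finite \<Rightarrow>\<^sub>0 nat"
  shows "mon_deg m = (\<Sum>x\<in>UNIV. Poly_Mapping.lookup m x)"
  unfolding mon_deg_def by (rule sum.mono_neutral_left) (auto simp: in_keys_iff)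

lemma mon_deg_add:
  fixes m :: "'a::finite \<Rightarrow>\<^sub>0 nat"
  shows "mon_deg (m + n) = mon_deg m + mon_deg n"
  by (simp add: mon_deg_eq_sum_UNIV lookup_add sum.distrib)

lemma mon_deg_sum:
  fixes f :: "'b \<Rightarrow> ('a::finite \<Rightarrow>\<^sub>0 nat)"
  shows "mon_deg (\<Sum>i\<in>A. f i) = (\<Sum>i\<in>A. mon_deg (f i))"
  by (induction A rule: infinite_finite_induct) (simp_all add: mon_deg_add, simp_all add: mon_deg_def)

lemma homogeneous_mult:
  fixes p q :: "('a::finite, 'k::field) mpoly"
  assumes "homogeneous d p" "homogeneous e q"
  shows "homogeneous (d + e) (p * q)"
  unfolding homogeneous_def
proof
  fix m assume "m \<in> Poly_Mapping.keys (p * q)"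
  then obtain a b where "m = a + b" "a \<in> Poly_Mapping.keys p" "b \<in> Poly_Mapping.keys q"
    using keys_mult[of p q] by blast
  then show "mon_deg m = d + e"
    using assms by (simp add: homogeneous_def mon_deg_add)
qed

lemma homogeneous_sum:
  assumes "\<And>i. i \<in> A \<Longrightarrow> homogeneous d (f i)"
  shows "homogeneous d (\<Sum>i\<in>A. f i)"
  using assms keys_sum[of f A] unfolding homogeneous_def by blast

lemma homogeneous_pvar: "homogeneous 1 (pvar x :: ('a, 'k::field) mpoly)"
  by (simp add: homogeneous_def mon_deg_def)

lemma homogeneous_0: "homogeneous d 0"
  by (simp add: homogeneous_def)

lemma homogeneous_uminus:
  fixes p :: "('a, 'k::field) mpoly"
  assumes "homogeneous d p"
  shows "homogeneous d (- p)"
  using assms by (auto simp: homogeneous_def in_keys_iff)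

text \<open>Drop all coefficient terms of the wrong degree.\<close>

lemma homogeneous_coefficients:
  fixes M :: "nat \<Rightarrow> nat \<Rightarrow> ('a::finite, 'k::field) mpoly"
  assumes N: "\<And>i. i < r \<Longrightarrow> homogeneous (d + p) (N i)"
    and M: "\<And>i l. i < r \<Longrightarrow> l < j \<Longrightarrow> homogeneous p (M i l)"
    and eq: "\<And>i. i < r \<Longrightarrow> N i = (\<Sum>l<j. c l * M i l)"
  shows "\<exists>c. (\<forall>l. homogeneous d (c l)) \<and> (\<forall>i<r. N i = (\<Sum>l<j. c l * M i l))"
proof -
  have "\<exists>c1 c2. c l = c1 + c2 \<and> homogeneous d c1 \<and> (\<forall>m\<in>Poly_Mapping.keys c2. mon_deg m \<noteq> d)" for l
    by (rule poly_mapping_split[of "c l" "\<lambda>m. mon_deg m = d"]) (auto simp: homogeneous_def)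
  then obtain c1 c2 where c: "\<And>l. c l = c1 l + c2 l" "\<And>l. homogeneous d (c1 l)"
    "\<And>l m. m \<in> Poly_Mapping.keys (c2 l) \<Longrightarrow> mon_deg m \<noteq> d" by metis
  have "N i = (\<Sum>l<j. c1 l * M i l)" if i: "i < r" for i
  proof -
    let ?L = "N i - (\<Sum>l<j. c1 l * M i l)" and ?R = "\<Sum>l<j. c2 l * M i l"
    \<comment> \<open>\<open>?L\<close> lives in degree \<open>d + p\<close> and \<open>?R\<close>
      outside that degree; being equal, both vanish.\<close>
    have LR: "?L = ?R"
      using eq[OF i] by (simp add: c(1) distrib_right sum.distrib)
    have L: "homogeneous (d + p) ?L"
    proof -
      have "homogeneous (d + p) (\<Sum>l<j. c1 l * M i l)"
        using i c(2) M by (intro homogeneous_sum homogeneous_mult) auto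
      then show ?thesis
        using N[OF i] keys_diff[of "N i" "\<Sum>l<j. c1 l * M i l"] unfolding homogeneous_def by blast
    qed
    have R: "mon_deg m \<noteq> d + p" if "m \<in> Poly_Mapping.keys ?R" for m
    proof -
      from that keys_sum[of "\<lambda>l. c2 l * M i l" "{..<j}"]
      obtain l where l: "l < j" "m \<in> Poly_Mapping.keys (c2 l * M i l)" by auto
      then obtain a b where "m = a + b" "a \<in> Poly_Mapping.keys (c2 l)" "b \<in> Poly_Mapping.keys (M i l)"
        using keys_mult[of "c2 l" "M i l"] by blast
      then show ?thesis
        using c(3) M[OF i l(1)] by (auto simp: mon_deg_add homogeneous_def)
    qed
    have "Poly_Mapping.keys ?L = {}"
      using L R unfolding LR homogeneous_def by blast
    then show ?thesis by simp
  qed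
  then show ?thesis using c(2) by blast
qed

section \<open>Ideals generated by variables\<close>

lemma in_var_ideal_0 [simp]: "in_var_ideal S 0"
  by (simp add: in_var_ideal_def)

lemma in_var_ideal_sum:
  assumes "\<And>i. i \<in> A \<Longrightarrow> in_var_ideal S (f i)"
  shows "in_var_ideal S (\<Sum>i\<in>A. f i)"
  using assms keys_sum[of f A] unfolding in_var_ideal_def by blast

lemma in_var_ideal_times_pvar:
  assumes "x \<in> S"
  shows "in_var_ideal S (p * pvar x)"
  unfolding in_var_ideal_def
proof
  fix m assume "m \<in> Poly_Mapping.keys (p * pvar x)"
  then obtain a where "m = a + mvar x"
    using keys_mult[of p "pvar x"] by auto
  then show "\<exists>x\<in>S. 0 < Poly_Mapping.lookup m x"
    using assms by (intro bexI[of _ x]) (auto simp: lookup_add)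
qed

text \<open>A variable outside \<open>S\<close> is a nonzerodivisor modulo the ideal of
  \<open>S\<close>: it changes only the exponent of \<open>x\<close>, which plays no part in
  divisibility by variables of \<open>S\<close>.\<close>

lemma in_var_ideal_times_pvarD:
  assumes "in_var_ideal S (p * pvar x)" "x \<notin> S"
  shows "in_var_ideal S p"
  unfolding in_var_ideal_def
proof
  fix m assume "m \<in> Poly_Mapping.keys p"
  then have "m + mvar x \<in> Poly_Mapping.keys (p * pvar x)"
    by (simp add: in_keys_iff lookup_times_single_add)
  then obtain y where y: "y \<in> S" "0 < Poly_Mapping.lookup (m + mvar x) y"
    using assms(1) unfolding in_var_ideal_def by blast
  then show "\<exists>x\<in>S. 0 < Poly_Mapping.lookup m x"
    using assms(2) by (intro bexI[of _ y]) (auto simp: lookup_add lookup_single when_def split: if_splits)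
qed

lemma mvar_dvd_imp:
  assumes "0 < Poly_Mapping.lookup m x"
  shows "\<exists>n. m = n + mvar x"
proof
  show "m = (m - mvar x) + mvar x"
    using assms by (intro poly_mapping_eqI) (auto simp: lookup_add lookup_minus lookup_single when_def)
qed

lemma in_var_ideal_imp_combination:
  fixes p :: "('a::finite, 'k::field) mpoly"
  assumes "in_var_ideal S p"
  shows "\<exists>f. p = (\<Sum>x\<in>S. f x * pvar x)"
proof -
  have "\<exists>f. (\<Sum>m\<in>K. Poly_Mapping.single m (Poly_Mapping.lookup p m)) = (\<Sum>x\<in>S. f x * pvar x)"
    if "finite K" "K \<subseteq> Poly_Mapping.keys p" for K
    using that
  proof (induction K rule: finite_induct)
    case empty
    show ?case by (intro exI[of _ "\<lambda>_. 0"]) simp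
  next
    case (insert m K)
    then obtain f where f: "(\<Sum>m\<in>K. Poly_Mapping.single m (Poly_Mapping.lookup p m)) = (\<Sum>x\<in>S. f x * pvar x)"
      by auto
    obtain y where y: "y \<in> S" "0 < Poly_Mapping.lookup m y"
      using assms insert.prems unfolding in_var_ideal_def by blast
    obtain n where n: "m = n + mvar y" using mvar_dvd_imp[OF y(2)] by blast
    let ?c = "Poly_Mapping.single n (Poly_Mapping.lookup p m)"
    have "(\<Sum>x\<in>S. (f x + (if x = y then ?c else 0)) * pvar x)
        = (\<Sum>x\<in>S. f x * pvar x) + (\<Sum>x\<in>S. if x = y then ?c * pvar y else 0)"
      unfolding sum.distrib[symmetric] by (rule sum.cong) (auto simp: distrib_right)
    also have "(\<Sum>x\<in>S. if x = y then ?c * pvar y else 0) = Poly_Mapping.single m (Poly_Mapping.lookup p m)"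
      using y(1) n by (simp add: mult_single)
    finally show ?case
      using insert.hyps f by (intro exI[of _ "\<lambda>x. f x + (if x = y then ?c else 0)"]) simp
  qed
  from this[of "Poly_Mapping.keys p"] show ?thesis
    using poly_mapping_sum_single[of p] by simp
qed

section \<open>Linear quotients\<close>

text \<open>The columns of the matrix \<open>M\<close> have linear quotients: the colon ideal of the span of the columns
  before \<open>j\<close> by column \<open>j\<close> is generated by the variables in \<open>S j\<close>.\<close>

definition linear_quotients ::
    "nat \<Rightarrow> nat \<Rightarrow> (nat \<Rightarrow> nat \<Rightarrow> ('a, 'k::field) mpoly) \<Rightarrow> (nat \<Rightarrow> 'a set) \<Rightarrow> bool" where
  "linear_quotients r b M S \<longleftrightarrow>
    (\<forall>j<b. (\<forall>x\<in>S j. \<exists>c. \<forall>i<r. pvar x * M i j = (\<Sum>l<j. c l * M i l)) \<and>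
           (\<forall>a c. (\<forall>i<r. a * M i j = (\<Sum>l<j. c l * M i l)) \<longrightarrow> in_var_ideal (S j) a))"

text \<open>The syzygies \<open>x e\<^sub>j - \<Sum>\<^sub>l\<^sub><\<^sub>j c\<^sub>l e\<^sub>l\<close> for \<open>x \<in> S j\<close> generate all syzygies. Ordered by \<open>j\<close> they have
  linear quotients again, since the coordinate \<open>j\<close> of a relation among them is a relation
  among variables.\<close>

lemma linear_quotients_syzygies:
  fixes M :: "nat \<Rightarrow> nat \<Rightarrow> ('a::finite, 'k::field) mpoly"
  assumes lq: "linear_quotients r b M S"
    and hom: "\<And>i j. i < r \<Longrightarrow> j < b \<Longrightarrow> homogeneous p (M i j)"
  shows "\<exists>b' D S'. linear_quotients b b' D S' \<and> (\<forall>i<b. \<forall>j<b'. homogeneous 1 (D i j)) \<and>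
    {v \<in> fvec b. \<forall>i<r. (\<Sum>j<b. M i j * v j) = 0} = mat_app b b' D ` fvec b'"
proof -
  \<comment> \<open>The colon condition supplies arbitrary coefficients; comparing degrees turns
    them into linear forms, as the next matrix must have.\<close>
  have ex: "\<exists>c. (\<forall>l. homogeneous 1 (c l)) \<and> (\<forall>i<r. pvar x * M i j = (\<Sum>l<j. c l * M i l))"
    if jx: "j < b" "x \<in> S j" for j x
  proof -
    obtain c where "\<forall>i<r. pvar x * M i j = (\<Sum>l<j. c l * M i l)"
      using lq jx unfolding linear_quotients_def by blast
    then show ?thesis
      using jx by (intro homogeneous_coefficients[where p = p] homogeneous_mult homogeneous_pvar hom) auto
  qed
  define c where "c j x = (SOME c. (\<forall>l. homogeneous 1 (c l)) \<and>
    (\<forall>i<r. pvar x * M i j = (\<Sum>l<j. c l * M i l)))" for j x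
  have c_hom: "homogeneous 1 (c j x l)"
    and c_eq: "i < r \<Longrightarrow> pvar x * M i j = (\<Sum>l<j. c j x l * M i l)" if "j < b" "x \<in> S j" for j x i l
    using someI_ex[OF ex[OF that]] unfolding c_def[symmetric] by auto
  have colon: "in_var_ideal (S j) a" if "j < b" "\<And>i. i < r \<Longrightarrow> a * M i j = (\<Sum>l<j. d l * M i l)" for j a d
    using lq that unfolding linear_quotients_def by blast
  obtain xs where xs: "set xs = Sigma {..<b} S" "distinct xs"
    using finite_distinct_list[of "Sigma {..<b} S"] by auto
  define P where "P = sort_key fst xs"
  have P: "set P = Sigma {..<b} S" "distinct P" "sorted (map fst P)"
    using xs by (simp_all add: P_def)
  define b' where "b' = length P"
  define J where "J s = fst (P ! s)" for s
  define X where "X s = snd (P ! s)" for s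
  have JX: "J s < b" "X s \<in> S (J s)" if "s < b'" for s
  proof -
    have "P ! s \<in> Sigma {..<b} S"
      unfolding P(1)[symmetric] using that by (simp add: b'_def)
    then show "J s < b" "X s \<in> S (J s)"
      by (cases "P ! s"; simp add: J_def X_def)+
  qed
  have J_mono: "J t \<le> J s" if "t \<le> s" "s < b'" for s t
    using P(3) that by (auto simp: J_def b'_def sorted_iff_nth_mono)
  have JX_inj: "s = t" if "J s = J t" "X s = X t" "s < b'" "t < b'" for s t
    using that nth_eq_iff_index_eq[OF P(2), of s t] by (simp add: J_def X_def b'_def prod_eq_iff)
  have JX_surj: "\<exists>s<b'. J s = j \<and> X s = x" if "j < b" "x \<in> S j" for j x
  proof -
    have "(j, x) \<in> set P" using that by (simp add: P(1))
    then obtain s where "s < length P" "P ! s = (j, x)" by (auto simp: in_set_conv_nth)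
    then show ?thesis by (auto simp: b'_def J_def X_def)
  qed
  \<comment> \<open>Column \<open>s\<close> has leading coordinate \<open>J s\<close>, where its
    entry is the bare variable \<open>X s\<close>; beyond that coordinate it is zero.\<close>
  define D where "D l s = (if l = J s then pvar (X s) else if l < J s then - c (J s) (X s) l else 0)" for l s
  \<comment> \<open>At coordinate \<open>J s\<close>, earlier columns with the same leading
    coordinate show a variable and all other earlier columns vanish.\<close>
  define S' where "S' s = {X t | t. t < s \<and> J t = J s}" for s
  have D_hom: "homogeneous 1 (D l s)" if "s < b'" for l s
    using JX[OF that] c_hom homogeneous_pvar by (auto simp: D_def homogeneous_uminus homogeneous_0)
  have D_syz: "(\<Sum>l<b. M i l * D l s) = 0" if "i < r" "s < b'" for i s
  proof -
    have "(\<Sum>l<b. M i l * D l s) = (\<Sum>l<Suc (J s). M i l * D l s)"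
      using JX(1)[OF that(2)] by (intro sum.mono_neutral_right) (auto simp: D_def)
    also have "\<dots> = (\<Sum>l<J s. M i l * - c (J s) (X s) l) + M i (J s) * pvar (X s)"
      by (simp add: D_def)
    also have "\<dots> = 0"
      using c_eq[OF JX[OF that(2)] that(1)] by (simp add: sum_negf mult.commute)
    finally show ?thesis .
  qed
  have comb_syz: "(\<Sum>l<b. M i l * (\<Sum>s<b'. D l s * w s)) = 0" if "i < r" for i w
  proof -
    have "(\<Sum>l<b. M i l * (\<Sum>s<b'. D l s * w s)) = (\<Sum>s<b'. (\<Sum>l<b. M i l * D l s) * w s)"
      unfolding sum_distrib_left sum_distrib_right mult.assoc by (rule sum.swap)
    then show ?thesis using that by (simp add: D_syz)
  qed
  \<comment> \<open>Elimination from the top coordinate down. The clause on \<open>w\<close> records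
    that a syzygy supported below \<open>n\<close> needs only columns led below \<open>n\<close>;
    this is what later keeps combinations among earlier columns.\<close>
  have generate: "\<exists>w. (\<forall>s<b'. n \<le> J s \<longrightarrow> w s = 0) \<and> (\<forall>l<b. v l = (\<Sum>s<b'. D l s * w s))"
    if "n \<le> b" "\<And>l. n \<le> l \<Longrightarrow> l < b \<Longrightarrow> v l = 0" "\<And>i. i < r \<Longrightarrow> (\<Sum>l<b. M i l * v l) = 0" for n v
    using that
  proof (induction n arbitrary: v)
    case 0
    then show ?case by (intro exI[of _ "\<lambda>_. 0"]) auto
  next
    case (Suc n)
    have nb: "n < b" using Suc.prems(1) by simp
    have "v n * M i n = (\<Sum>l<n. (- v l) * M i l)" if "i < r" for i
    proof -
      have "(\<Sum>l<b. M i l * v l) = (\<Sum>l<Suc n. M i l * v l)"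
        using Suc.prems(1,2) by (intro sum.mono_neutral_right) auto
      then have "(\<Sum>l<n. M i l * v l) + M i n * v n = 0"
        using Suc.prems(3)[OF that] by simp
      then show ?thesis
        by (simp add: sum_negf mult.commute eq_neg_iff_add_eq_0 add.commute)
    qed
    then have "in_var_ideal (S n) (v n)"
      by (rule colon[OF nb, where d = "\<lambda>l. - v l"])
    then obtain f where f: "v n = (\<Sum>x\<in>S n. f x * pvar x)"
      using in_var_ideal_imp_combination by blast
    define w0 where "w0 s = (if J s = n then f (X s) else 0)" for s
    have top: "(\<Sum>s<b'. D n s * w0 s) = v n"
    proof -
      have "(\<Sum>s<b'. D n s * w0 s) = (\<Sum>s\<in>{s. s < b' \<and> J s = n}. pvar (X s) * f (X s))"
        by (rule sum.mono_neutral_cong_right) (auto simp: w0_def D_def)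
      also have "\<dots> = (\<Sum>x\<in>S n. pvar x * f x)"
      proof (rule sum.reindex_bij_betw[where h = X])
        show "bij_betw X {s. s < b' \<and> J s = n} (S n)"
          unfolding bij_betw_def
        proof
          show "inj_on X {s. s < b' \<and> J s = n}" using JX_inj by (auto intro!: inj_onI)
          show "X ` {s. s < b' \<and> J s = n} = S n"
            using JX JX_surj[OF nb] by (auto simp: image_iff) metis+
        qed
      qed
      finally show ?thesis by (simp add: f mult.commute)
    qed
    define v' where "v' l = v l - (\<Sum>s<b'. D l s * w0 s)" for l
    have v'0: "v' l = 0" if "n \<le> l" "l < b" for l
    proof (cases "l = n")
      case True
      then show ?thesis by (simp add: v'_def top)
    next
      case False
      have "(\<Sum>s<b'. D l s * w0 s) = 0"
        using False that by (intro sum.neutral) (auto simp: D_def w0_def)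
      then show ?thesis using Suc.prems(2)[of l] that False by (simp add: v'_def)
    qed
    have v'syz: "(\<Sum>l<b. M i l * v' l) = 0" if "i < r" for i
      using Suc.prems(3)[OF that] comb_syz[OF that, of w0]
      by (simp add: v'_def right_diff_distrib sum_subtractf)
    obtain w where w: "\<And>s. s < b' \<Longrightarrow> n \<le> J s \<Longrightarrow> w s = 0" "\<And>l. l < b \<Longrightarrow> v' l = (\<Sum>s<b'. D l s * w s)"
      using Suc.IH[of v'] nb v'0 v'syz by auto
    show ?case
    proof (intro exI[of _ "\<lambda>s. w s + w0 s"] conjI allI impI)
      fix s assume "s < b'" "Suc n \<le> J s"
      then show "w s + w0 s = 0" using w(1)[of s] by (simp add: w0_def)
    next
      fix l assume "l < b"
      then show "v l = (\<Sum>s<b'. D l s * (w s + w0 s))"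
        using w(2)[of l] by (simp add: v'_def distrib_left sum.distrib algebra_simps)
    qed
  qed
  have "linear_quotients b b' D S'"
    unfolding linear_quotients_def
  proof (intro allI impI conjI ballI)
    fix s x' assume s: "s < b'" and "x' \<in> S' s"
    then obtain t where t: "t < s" "J t = J s" "x' = X t" by (auto simp: S'_def)
    \<comment> \<open>The Koszul relation between \<open>x'\<close> and \<open>X s\<close> cancels
      the leading coordinate, leaving a syzygy supported below \<open>J s\<close>.\<close>
    define v where "v l = pvar x' * D l s - pvar (X s) * D l t" for l
    have v0: "v l = 0" if "J s \<le> l" for l
      using that t by (auto simp: v_def D_def mult.commute)
    have vsyz: "(\<Sum>l<b. M i l * v l) = 0" if "i < r" for i
    proof -
      have "(\<Sum>l<b. M i l * v l) = pvar x' * (\<Sum>l<b. M i l * D l s) - pvar (X s) * (\<Sum>l<b. M i l * D l t)"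
        by (simp add: v_def sum_subtractf sum_distrib_left right_diff_distrib mult_ac)
      then show ?thesis using D_syz that s t by simp
    qed
    obtain w where w: "\<And>s'. s' < b' \<Longrightarrow> J s \<le> J s' \<Longrightarrow> w s' = 0" "\<And>l. l < b \<Longrightarrow> v l = (\<Sum>s<b'. D l s * w s)"
      using generate[of "J s" v] JX(1)[OF s] v0 vsyz by auto
    have w_sum: "v l = (\<Sum>s'<s. D l s' * w s')" if "l < b" for l
      unfolding w(2)[OF that] using s w(1) J_mono
      by (intro sum.mono_neutral_right) (auto simp: not_less)
    show "\<exists>c. \<forall>l<b. pvar x' * D l s = (\<Sum>s'<s. c s' * D l s')"
    proof (intro exI[of _ "\<lambda>s'. w s' + (if s' = t then pvar (X s) else 0)"] allI impI)
      fix l assume l: "l < b"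
      have "(\<Sum>s'<s. (w s' + (if s' = t then pvar (X s) else 0)) * D l s')
          = (\<Sum>s'<s. D l s' * w s') + (\<Sum>s'<s. if s' = t then pvar (X s) * D l t else 0)"
        unfolding sum.distrib[symmetric] by (rule sum.cong) (auto simp: algebra_simps)
      also have "\<dots> = v l + pvar (X s) * D l t"
        using w_sum[OF l] t(1) by simp
      finally show "pvar x' * D l s = (\<Sum>s'<s. (w s' + (if s' = t then pvar (X s) else 0)) * D l s')"
        by (simp add: v_def)
    qed
  next
    fix s a d assume s: "s < b'" and eq: "\<forall>i<b. a * D i s = (\<Sum>t<s. d t * D i t)"
    \<comment> \<open>Coordinate \<open>J s\<close> turns the vector relation into one among
      variables, from which \<open>X s\<close> can be cancelled because it is not in
      \<open>S' s\<close>.\<close>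
    have "a * pvar (X s) = (\<Sum>t<s. d t * D (J s) t)"
      using eq[rule_format, OF JX(1)[OF s]] by (simp add: D_def[of "J s" s])
    moreover have "in_var_ideal (S' s) (d t * D (J s) t)" if "t < s" for t
    proof (cases "J t = J s")
      case True
      then have "D (J s) t = pvar (X t)" "X t \<in> S' s" using that by (auto simp: D_def S'_def)
      then show ?thesis by (simp add: in_var_ideal_times_pvar)
    next
      case False
      then show ?thesis using J_mono[of t s] that s by (auto simp: D_def)
    qed
    ultimately have "in_var_ideal (S' s) (a * pvar (X s))"
      by (auto intro!: in_var_ideal_sum)
    moreover have "X s \<notin> S' s"
    proof
      assume "X s \<in> S' s"
      then obtain t where "t < s" "J t = J s" "X s = X t" by (auto simp: S'_def)
      then show False using JX_inj[of s t] s by auto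
    qed
    ultimately show "in_var_ideal (S' s) a" by (rule in_var_ideal_times_pvarD)
  qed
  moreover have "{v \<in> fvec b. \<forall>i<r. (\<Sum>j<b. M i j * v j) = 0} = mat_app b b' D ` fvec b'" (is "?L = ?R")
  proof
    show "?R \<subseteq> ?L"
      using comb_syz by (auto simp: mat_app_def fvec_def)
    show "?L \<subseteq> ?R"
    proof
      fix v assume v: "v \<in> ?L"
      then obtain w where w: "\<And>l. l < b \<Longrightarrow> v l = (\<Sum>s<b'. D l s * w s)"
        using generate[of b v] by auto
      have "v = mat_app b b' D (\<lambda>s. if s < b' then w s else 0)"
        using v w by (auto simp: mat_app_def fvec_def fun_eq_iff)
      moreover have "(\<lambda>s. if s < b' then w s else 0) \<in> fvec b'" by (simp add: fvec_def)
      ultimately show "v \<in> ?R" by blast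
    qed
  qed
  ultimately show ?thesis using D_hom by blast
qed

section \<open>Iterated syzygies and the resolution\<close>

lemma linear_quotients_imp_linear_resolution:
  fixes g :: "nat \<Rightarrow> ('a::finite, 'k::field) mpoly"
  assumes lq: "linear_quotients 1 N (\<lambda>_. g) S"
    and hom: "\<And>j. j < N \<Longrightarrow> homogeneous q (g j)"
  shows "linear_resolution {(\<Sum>j<N. v j * g j) | v. True} q"
proof -
  \<comment> \<open>The state of the iteration consists of rows, columns, matrix and colon
    variables. The ideal enters as a matrix with one row; the common degree of the entries is
    \<open>q\<close> there and 1 for the syzygy matrices.\<close>
  define P :: "nat \<Rightarrow> nat \<times> nat \<times> (nat \<Rightarrow> nat \<Rightarrow> ('a, 'k) mpoly) \<times> (nat \<Rightarrow> 'a set) \<Rightarrow> bool"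
    where "P n = (\<lambda>(r, b, M, T). linear_quotients r b M T \<and>
      (\<exists>p. \<forall>i<r. \<forall>j<b. homogeneous p (M i j)) \<and> (n = 0 \<longrightarrow> r = 1 \<and> b = N \<and> M = (\<lambda>_. g)))" for n
  define Q :: "nat \<times> nat \<times> (nat \<Rightarrow> nat \<Rightarrow> ('a, 'k) mpoly) \<times> (nat \<Rightarrow> 'a set) \<Rightarrow>
      nat \<times> nat \<times> (nat \<Rightarrow> nat \<Rightarrow> ('a, 'k) mpoly) \<times> (nat \<Rightarrow> 'a set) \<Rightarrow> bool"
    where "Q = (\<lambda>(r, b, M, T) (r', b', D, T'). r' = b \<and> (\<forall>i<b. \<forall>j<b'. homogeneous 1 (D i j)) \<and>
      {v \<in> fvec b. \<forall>i<r. (\<Sum>j<b. M i j * v j) = 0} = mat_app b b' D ` fvec b')"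
  have "\<exists>f. \<forall>n. P n (f n) \<and> Q (f n) (f (Suc n))"
  proof (rule dependent_nat_choice)
    have "P 0 (1, N, \<lambda>_. g, S)"
      using lq hom by (auto simp: P_def)
    then show "\<exists>x. P 0 x" by blast
  next
    fix x n assume Px: "P n x"
    obtain r b M T where x: "x = (r, b, M, T)" by (cases x)
    obtain p where "linear_quotients r b M T" "\<And>i j. i < r \<Longrightarrow> j < b \<Longrightarrow> homogeneous p (M i j)"
      using Px by (auto simp: P_def x)
    then obtain b' D T' where *: "linear_quotients b b' D T'" "\<forall>i<b. \<forall>j<b'. homogeneous 1 (D i j)"
      "{v \<in> fvec b. \<forall>i<r. (\<Sum>j<b. M i j * v j) = 0} = mat_app b b' D ` fvec b'"
      using linear_quotients_syzygies[of r b M T p] by blast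
    then have "P (Suc n) (b, b', D, T') \<and> Q x (b, b', D, T')"
      by (auto simp: P_def Q_def x)
    then show "\<exists>y. P (Suc n) y \<and> Q x y" by blast
  qed
  then obtain f where f: "\<And>n. P n (f n)" "\<And>n. Q (f n) (f (Suc n))" by blast
  define R where "R n = fst (f n)" for n
  define b where "b n = fst (snd (f n))" for n
  define D where "D n = fst (snd (snd (f n)))" for n
  define T where "T n = snd (snd (snd (f n)))" for n
  have f_eq: "f n = (R n, b n, D n, T n)" for n
    by (simp add: R_def b_def D_def T_def)
  have zero: "R 0 = 1" "b 0 = N" "D 0 = (\<lambda>_. g)"
    using f(1)[of 0] unfolding f_eq[of 0] P_def by simp_all
  have R_Suc: "R (Suc n) = b n"
    and D_hom: "\<And>i j. i < b n \<Longrightarrow> j < b (Suc n) \<Longrightarrow> homogeneous 1 (D (Suc n) i j)"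
    and ker: "{v \<in> fvec (b n). \<forall>i<R n. (\<Sum>j<b n. D n i j * v j) = 0} =
      mat_app (b n) (b (Suc n)) (D (Suc n)) ` fvec (b (Suc n))" for n
    using f(2)[of n] unfolding f_eq[of n] f_eq[of "Suc n"] Q_def by simp_all
  show ?thesis
    unfolding linear_resolution_def
  proof (intro exI[of _ b] exI[of _ g] exI[of _ D] conjI allI impI)
    fix j assume "j < b 0"
    then show "homogeneous q (g j)" using hom zero by simp
  next
    fix i r c :: nat assume "1 \<le> i" "r < b (i - 1)" "c < b i"
    then show "homogeneous 1 (D i r c)" using D_hom[of r "i - 1" c] by simp
  next
    show "{(\<Sum>j<b 0. v j * g j) | v. True} = {(\<Sum>j<N. v j * g j) | v. True}"
      by (simp add: zero)
  next
    show "{v \<in> fvec (b 0). (\<Sum>j<b 0. v j * g j) = 0} = mat_app (b 0) (b 1) (D 1) ` fvec (b 1)"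
      using ker[of 0] by (simp add: zero mult.commute)
  next
    fix i :: nat assume "1 \<le> i"
    then obtain n where n: "i = Suc n" by (cases i) auto
    have "mat_app (b (i - 1)) (b i) (D i) v = (\<lambda>_. 0) \<longleftrightarrow> (\<forall>r<R i. (\<Sum>j<b i. D i r j * v j) = 0)" for v
      by (auto simp: mat_app_def fun_eq_iff n R_Suc)
    then show "{v \<in> fvec (b i). mat_app (b (i - 1)) (b i) (D i) v = (\<lambda>_. 0)} =
        mat_app (b i) (b (Suc i)) (D (Suc i)) ` fvec (b (Suc i))"
      using ker[of i] by simp
  qed
qed

section \<open>Monomial ideals with an exchange property\<close>

lemma ideal_gen_image_eq:
  fixes g :: "nat \<Rightarrow> 'r::comm_ring_1"
  assumes inj: "inj_on g {..<N}"
  shows "ideal_gen (g ` {..<N}) = {(\<Sum>j<N. v j * g j) | v. True}" (is "?L = ?R")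
proof
  show "?L \<subseteq> ?R"
  proof
    fix p assume "p \<in> ?L"
    then obtain A c where A: "A \<subseteq> g ` {..<N}" "p = (\<Sum>h\<in>A. c h * h)"
      by (auto simp: ideal_gen_def)
    have "p = (\<Sum>h\<in>g ` {..<N}. (if h \<in> A then c h else 0) * h)"
      unfolding A(2) using A(1) by (intro sum.mono_neutral_cong_left) auto
    also have "\<dots> = (\<Sum>j<N. (if g j \<in> A then c (g j) else 0) * g j)"
      by (subst sum.reindex[OF inj]) (simp add: o_def)
    finally show "p \<in> ?R"
      unfolding mem_Collect_eq by (intro exI[of _ "\<lambda>j. if g j \<in> A then c (g j) else 0"] conjI TrueI)
  qed
  show "?R \<subseteq> ?L"
  proof
    fix p assume "p \<in> ?R"
    then obtain v where v: "p = (\<Sum>j<N. v j * g j)" by blast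
    have "p = (\<Sum>h\<in>g ` {..<N}. v (the_inv_into {..<N} g h) * h)"
      unfolding v by (subst sum.reindex[OF inj]) (simp add: o_def the_inv_into_f_f[OF inj])
    then show "p \<in> ?L"
      unfolding ideal_gen_def by (auto intro!: exI[of _ "g ` {..<N}"])
  qed
qed

text \<open>If \<open>n\<close> multiplies \<open>m\<close> into the span of its predecessors, the
  product is a multiple of one predecessor \<open>m'\<close>, and every variable with larger
  exponent in \<open>m'\<close> than in \<open>m\<close> divides \<open>n\<close>. The exchange
  finds such an \<open>x\<close> for which \<open>x\<close> times \<open>m\<close> is a multiple of
  a monomial with smaller key. Equal keys are included in \<open>exch\<close> because sorting leaves
  ties in arbitrary order.\<close>

lemma monomial_ideal_linear_resolution:
  fixes B :: "('a::finite \<Rightarrow>\<^sub>0 nat) set" and key :: "('a \<Rightarrow>\<^sub>0 nat) \<Rightarrow> 'o::linorder"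
  assumes "finite B"
    and deg: "\<And>m. m \<in> B \<Longrightarrow> mon_deg m = q"
    and exch: "\<And>m m'. m \<in> B \<Longrightarrow> m' \<in> B \<Longrightarrow> m \<noteq> m' \<Longrightarrow> key m' \<le> key m \<Longrightarrow>
      \<exists>x y. \<exists>m''\<in>B. Poly_Mapping.lookup m x < Poly_Mapping.lookup m' x \<and>
        m'' + mvar y = m + mvar x \<and> key m'' < key m"
  shows "linear_resolution (ideal_gen ((\<lambda>m. Poly_Mapping.single m (1::'k::field)) ` B)) q"
proof -
  obtain xs where xs: "set xs = B" "distinct xs"
    using finite_distinct_list[OF \<open>finite B\<close>] by blast
  define L where "L = sort_key key xs"
  have L: "set L = B" "distinct L" "sorted (map key L)"
    using xs by (simp_all add: L_def)
  define g where "g j = (Poly_Mapping.single (L ! j) 1 :: ('a, 'k) mpoly)" for j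
  define N where "N = length L"
  have LB: "L ! j \<in> B" if "j < N" for j
    using that nth_mem[of j L] by (simp add: L(1) N_def)
  have key_mono: "key (L ! i) \<le> key (L ! j)" if "i \<le> j" "j < N" for i j
    using sorted_nth_mono[OF L(3), of i j] that by (simp add: N_def)
  have L_eq: "L ! i = L ! j \<longleftrightarrow> i = j" if "i < N" "j < N" for i j
    using that nth_eq_iff_index_eq[OF L(2)] by (simp add: N_def)
  have single_eq: "Poly_Mapping.single m (1::'k) = Poly_Mapping.single n 1 \<longleftrightarrow> m = n"
    for m n :: "'a \<Rightarrow>\<^sub>0 nat"
  proof
    assume "Poly_Mapping.single m (1::'k) = Poly_Mapping.single n 1"
    then have "Poly_Mapping.keys (Poly_Mapping.single m (1::'k)) = Poly_Mapping.keys (Poly_Mapping.single n (1::'k))"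
      by simp
    then show "m = n" by simp
  qed simp
  have inj: "inj_on g {..<N}"
    by (auto simp: inj_on_def g_def single_eq L_eq)
  have img: "g ` {..<N} = (\<lambda>m. Poly_Mapping.single m 1) ` B"
  proof -
    have "B = (!) L ` {..<N}" by (auto simp: L(1)[symmetric] in_set_conv_nth N_def)
    then show ?thesis by (auto simp: g_def)
  qed
  \<comment> \<open>Taking all variables of the colon ideal makes one half of the definition
    immediate; the work is to show that they generate it.\<close>
  define S where "S j = {x. \<exists>c. pvar x * g j = (\<Sum>l<j. c l * g l)}" for j
  have "linear_quotients 1 N (\<lambda>_. g) S"
    unfolding linear_quotients_def
  proof (intro allI impI conjI ballI)
    fix j x assume "x \<in> S j"
    then show "\<exists>c. \<forall>i<(1::nat). pvar x * g j = (\<Sum>l<j. c l * g l)" by (auto simp: S_def)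
  next
    fix j a c assume j: "j < N" and "\<forall>i<(1::nat). a * g j = (\<Sum>l<j. c l * g l)"
    then have eq: "a * g j = (\<Sum>l<j. c l * g l)" by simp
    show "in_var_ideal (S j) a"
      unfolding in_var_ideal_def
    proof
      fix n assume "n \<in> Poly_Mapping.keys a"
      then have "n + L ! j \<in> Poly_Mapping.keys (\<Sum>l<j. c l * g l)"
        unfolding eq[symmetric] by (simp add: in_keys_iff g_def lookup_times_single_add)
      then obtain l where l: "l < j" "n + L ! j \<in> Poly_Mapping.keys (c l * g l)"
        using keys_sum[of "\<lambda>l. c l * g l" "{..<j}"] by blast
      then obtain n' where n': "n + L ! j = n' + L ! l"
        using keys_mult[of "c l" "g l"] by (auto simp: g_def)
      have "L ! j \<noteq> L ! l" "key (L ! l) \<le> key (L ! j)"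
        using l(1) j L_eq[of j l] key_mono[of l j] by auto
      then obtain x y m'' where m'': "m'' \<in> B" "Poly_Mapping.lookup (L ! j) x < Poly_Mapping.lookup (L ! l) x"
        "m'' + mvar y = L ! j + mvar x" "key m'' < key (L ! j)"
        using exch[of "L ! j" "L ! l"] LB[of j] LB[of l] l(1) j by auto
      obtain t where t: "t < N" "m'' = L ! t"
        using m''(1) by (auto simp: L(1)[symmetric] in_set_conv_nth N_def)
      have tj: "t < j"
      proof (rule ccontr)
        assume "\<not> t < j"
        then show False using key_mono[of j t] t m''(4) by simp
      qed
      have "pvar x * g j = pvar y * g t"
        using m''(3) by (simp add: g_def mult_single t(2) add.commute)
      also have "\<dots> = (\<Sum>l<j. if l = t then pvar y * g t else 0)" using tj by simp
      also have "\<dots> = (\<Sum>l<j. (if l = t then pvar y else 0) * g l)" by (rule sum.cong) auto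
      finally have "x \<in> S j"
        unfolding S_def mem_Collect_eq by (intro exI[of _ "\<lambda>l. if l = t then pvar y else 0"])
      moreover have "0 < Poly_Mapping.lookup n x"
        using m''(2) arg_cong[OF n', of "\<lambda>m. Poly_Mapping.lookup m x"] by (simp add: lookup_add)
      ultimately show "\<exists>x\<in>S j. 0 < Poly_Mapping.lookup n x" by blast
    qed
  qed
  moreover have "homogeneous q (g j)" if "j < N" for j
    using deg[OF LB[OF that]] by (simp add: homogeneous_def g_def)
  ultimately have "linear_resolution {(\<Sum>j<N. v j * g j) | v. True} q"
    by (rule linear_quotients_imp_linear_resolution)
  then show ?thesis
    by (simp only: ideal_gen_image_eq[OF inj, symmetric] img)
qed

section \<open>Powers of squarefree monomial ideals\<close>

lemma ideal_gen_base: "g \<in> G \<Longrightarrow> g \<in> ideal_gen G"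
  unfolding ideal_gen_def mem_Collect_eq by (intro exI[of _ "{g}"] exI[of _ "\<lambda>_. 1"]) simp

lemma ideal_gen_mult:
  assumes "p \<in> ideal_gen G"
  shows "r * p \<in> ideal_gen G"
proof -
  obtain A c where "finite A" "A \<subseteq> G" "p = (\<Sum>g\<in>A. c g * g)"
    using assms by (auto simp: ideal_gen_def)
  then show ?thesis
    unfolding ideal_gen_def
    by (auto intro!: exI[of _ A] exI[of _ "\<lambda>g. r * c g"] simp: sum_distrib_left mult.assoc)
qed

lemma ideal_gen_add:
  assumes "p \<in> ideal_gen G" "q \<in> ideal_gen G"
  shows "p + q \<in> ideal_gen G"
proof -
  obtain A c where A: "finite A" "A \<subseteq> G" "p = (\<Sum>g\<in>A. c g * g)"
    using assms(1) by (auto simp: ideal_gen_def)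
  obtain B d where B: "finite B" "B \<subseteq> G" "q = (\<Sum>g\<in>B. d g * g)"
    using assms(2) by (auto simp: ideal_gen_def)
  have "p = (\<Sum>g\<in>A \<union> B. (if g \<in> A then c g else 0) * g)"
    unfolding A(3) using A(1) B(1) by (intro sum.mono_neutral_cong_left) auto
  moreover have "q = (\<Sum>g\<in>A \<union> B. (if g \<in> B then d g else 0) * g)"
    unfolding B(3) using A(1) B(1) by (intro sum.mono_neutral_cong_left) auto
  ultimately have "p + q = (\<Sum>g\<in>A \<union> B. ((if g \<in> A then c g else 0) + (if g \<in> B then d g else 0)) * g)"
    by (simp add: distrib_right sum.distrib)
  then show ?thesis
    unfolding ideal_gen_def mem_Collect_eq
    using A(1,2) B(1,2)
    by (intro exI[of _ "A \<union> B"]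
        exI[of _ "\<lambda>g. (if g \<in> A then c g else 0) + (if g \<in> B then d g else 0)"]) auto
qed

lemma ideal_gen_sum:
  assumes "\<And>i. i \<in> A \<Longrightarrow> f i \<in> ideal_gen G"
  shows "(\<Sum>i\<in>A. f i) \<in> ideal_gen G"
proof -
  have zero: "0 \<in> ideal_gen G"
    unfolding ideal_gen_def by (auto intro!: exI[of _ "{}"])
  show ?thesis
    using assms by (induction A rule: infinite_finite_induct) (auto simp: zero ideal_gen_add)
qed

lemma ideal_gen_least:
  assumes "G \<subseteq> ideal_gen H"
  shows "ideal_gen G \<subseteq> ideal_gen H"
proof
  fix p assume "p \<in> ideal_gen G"
  then obtain A c where "A \<subseteq> G" "p = (\<Sum>g\<in>A. c g * g)"
    by (auto simp: ideal_gen_def)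
  then show "p \<in> ideal_gen H"
    using assms by (auto intro!: ideal_gen_sum intro: ideal_gen_mult)
qed

text \<open>Multilinear expansion of a product of linear combinations, one factor at a time.\<close>

lemma prod_in_ideal_gen:
  fixes f :: "nat \<Rightarrow> 'r::comm_ring_1"
  assumes "\<And>i. i < k \<Longrightarrow> f i \<in> ideal_gen G"
  shows "(\<Prod>i<k. f i) \<in> ideal_gen {\<Prod>i<k. h i | h. \<forall>i<k. h i \<in> G}"
  using assms
proof (induction k)
  case 0
  show ?case by (rule ideal_gen_base) simp
next
  case (Suc k)
  let ?H = "\<lambda>k. {\<Prod>i<k. h i | h. \<forall>i<k. h i \<in> G}"
  have IH: "(\<Prod>i<k. f i) \<in> ideal_gen (?H k)" using Suc by simp
  have step: "p * g \<in> ideal_gen (?H (Suc k))" if p: "p \<in> ideal_gen (?H k)" and g: "g \<in> G" for p g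
  proof -
    have base: "h * g \<in> ideal_gen (?H (Suc k))" if h: "h \<in> ?H k" for h
    proof (rule ideal_gen_base)
      obtain t where t: "h = (\<Prod>i<k. t i)" "\<forall>i<k. t i \<in> G" using h by blast
      have "h * g = (\<Prod>i<Suc k. (t(k := g)) i)" by (simp add: t(1))
      moreover have "\<forall>i<Suc k. (t(k := g)) i \<in> G" using t(2) g by (auto simp: less_Suc_eq)
      ultimately show "h * g \<in> ?H (Suc k)" by blast
    qed
    obtain A d where A: "A \<subseteq> ?H k" "p = (\<Sum>h\<in>A. d h * h)"
      using p by (auto simp: ideal_gen_def)
    have "p * g = (\<Sum>h\<in>A. d h * (h * g))"
      by (simp add: A(2) sum_distrib_right mult.assoc)
    also have "\<dots> \<in> ideal_gen (?H (Suc k))"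
      by (rule ideal_gen_sum, rule ideal_gen_mult, rule base) (use A(1) in blast)
    finally show ?thesis .
  qed
  obtain A c where A: "A \<subseteq> G" "f k = (\<Sum>g\<in>A. c g * g)"
    using Suc.prems[of k] by (auto simp: ideal_gen_def)
  have "(\<Prod>i<Suc k. f i) = (\<Sum>g\<in>A. c g * ((\<Prod>i<k. f i) * g))"
    by (simp add: A(2) sum_distrib_left mult_ac)
  also have "\<dots> \<in> ideal_gen (?H (Suc k))"
    by (rule ideal_gen_sum, rule ideal_gen_mult, rule step[OF IH]) (use A(1) in blast)
  finally show ?case .
qed

lemma ideal_pow_ideal_gen:
  "ideal_pow (ideal_gen G) k = ideal_gen {\<Prod>i<k. h i | h. \<forall>i<k. h i \<in> G}"
  unfolding ideal_pow_def
proof (rule antisym)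
  show "ideal_gen {\<Prod>i<k. h i | h. \<forall>i<k. h i \<in> ideal_gen G} \<subseteq> ideal_gen {\<Prod>i<k. h i | h. \<forall>i<k. h i \<in> G}"
    by (rule ideal_gen_least) (auto intro!: prod_in_ideal_gen)
  show "ideal_gen {\<Prod>i<k. h i | h. \<forall>i<k. h i \<in> G} \<subseteq> ideal_gen {\<Prod>i<k. h i | h. \<forall>i<k. h i \<in> ideal_gen G}"
    by (rule ideal_gen_least) (auto intro!: ideal_gen_base dest: ideal_gen_base)
qed

definition set_mon :: "'a set \<Rightarrow> ('a \<Rightarrow>\<^sub>0 nat)" where
  "set_mon F = (\<Sum>x\<in>F. mvar x)"

lemma lookup_set_mon:
  fixes F :: "'a::finite set"
  shows "Poly_Mapping.lookup (set_mon F) x = (if x \<in> F then 1 else 0)"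
  by (simp add: set_mon_def lookup_sum lookup_single when_def)

lemma prod_single_one:
  "(\<Prod>i\<in>A. Poly_Mapping.single (f i) 1) = (Poly_Mapping.single (\<Sum>i\<in>A. f i) 1 :: ('a, 'k::field) mpoly)"
  by (induction A rule: infinite_finite_induct) (simp_all add: mult_single)

lemma ideal_pow_xmon:
  "ideal_pow (ideal_gen {xmon F :: ('a, 'k::field) mpoly | F. F \<in> \<F>}) k =
    ideal_gen ((\<lambda>m. Poly_Mapping.single m 1) ` {\<Sum>i<k. set_mon (F i) | F. \<forall>i<k. F i \<in> \<F>})"
proof -
  have "{\<Prod>i<k. h i | h. \<forall>i<k. h i \<in> {xmon F :: ('a, 'k) mpoly | F. F \<in> \<F>}} =
      (\<lambda>m. Poly_Mapping.single m 1) ` {\<Sum>i<k. set_mon (F i) | F. \<forall>i<k. F i \<in> \<F>}" (is "?L = ?R")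
  proof
    show "?L \<subseteq> ?R"
    proof
      fix p assume "p \<in> ?L"
      then obtain h where h: "p = (\<Prod>i<k. h i)" "\<forall>i<k. \<exists>F. h i = xmon F \<and> F \<in> \<F>" by blast
      then obtain F where F: "\<And>i. i < k \<Longrightarrow> h i = xmon (F i)" "\<And>i. i < k \<Longrightarrow> F i \<in> \<F>" by metis
      have "p = (\<Prod>i<k. Poly_Mapping.single (set_mon (F i)) 1)"
        unfolding h(1) by (rule prod.cong) (simp_all add: F(1) xmon_def set_mon_def)
      then have "p = Poly_Mapping.single (\<Sum>i<k. set_mon (F i)) 1" by (simp add: prod_single_one)
      then show "p \<in> ?R" using F(2) by blast
    qed
    show "?R \<subseteq> ?L"
    proof
      fix p :: "('a, 'k) mpoly" assume "p \<in> ?R"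
      then obtain F where F: "p = Poly_Mapping.single (\<Sum>i<k. set_mon (F i)) 1" "\<forall>i<k. F i \<in> \<F>" by blast
      then have "p = (\<Prod>i<k. xmon (F i))"
        by (simp add: xmon_def prod_single_one set_mon_def)
      then show "p \<in> ?L" using F(2) by blast
    qed
  qed
  then show ?thesis by (simp only: ideal_pow_ideal_gen)
qed

section \<open>Exchanging non-edges\<close>

definition pair_mon :: "'a \<times> 'a \<Rightarrow> ('a \<Rightarrow>\<^sub>0 nat)" where
  "pair_mon e = mvar (fst e) + mvar (snd e)"

text \<open>As a function of the vertex, this is the degree sequence of the multigraph with edge
  multiset \<open>W\<close>.\<close>

definition pairs_mon :: "('a \<times> 'a) multiset \<Rightarrow> ('a \<Rightarrow>\<^sub>0 nat)" where
  "pairs_mon W = (\<Sum>e\<in>#W. pair_mon e)"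

lemma pairs_mon_simps [simp]:
  "pairs_mon {#} = 0"
  "pairs_mon (add_mset e W) = pair_mon e + pairs_mon W"
  "pairs_mon (V + W) = pairs_mon V + pairs_mon W"
  by (simp_all add: pairs_mon_def)

lemma pairs_mon_diff:
  assumes "A \<subseteq># W"
  shows "pairs_mon W = pairs_mon A + pairs_mon (W - A)"
  using assms by (metis pairs_mon_simps(3) subset_mset.add_diff_inverse)

lemma mon_deg_pairs_mon:
  fixes W :: "('a::finite \<times> 'a) multiset"
  shows "mon_deg (pairs_mon W) = 2 * size W"
proof (induction W)
  case empty
  show ?case by (simp add: mon_deg_def)
next
  case (add e W)
  then show ?case by (simp add: mon_deg_add pair_mon_def mon_deg_def[of "mvar _"])
qed

text \<open>A vertex of positive degree lies on an edge, with other end \<open>y\<close>. The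
  equation for \<open>pair_mon e\<close> ignores the stored order of the ends; the last clause keeps
  it for comparing codes.\<close>

lemma lookup_pairs_mon_pos:
  assumes "0 < Poly_Mapping.lookup (pairs_mon W) x"
  obtains e y where "e \<in># W" "pair_mon e = mvar x + mvar y" "e = (x, y) \<or> e = (y, x)"
proof -
  have "\<exists>e\<in>#W. 0 < Poly_Mapping.lookup (pair_mon e) x"
    using assms by (induction W) (auto simp: lookup_add)
  then obtain e where e: "e \<in># W" "0 < Poly_Mapping.lookup (pair_mon e) x" by blast
  have "fst e = x \<or> snd e = x"
    using e(2) by (auto simp: pair_mon_def lookup_add lookup_single when_def split: if_splits)
  then show ?thesis
    using that[OF e(1), of "snd e"] that[OF e(1), of "fst e"]
    by (cases e) (auto simp: pair_mon_def add.commute)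
qed

lemma lookup_mono_imp_eq:
  fixes m n :: "'a::finite \<Rightarrow>\<^sub>0 nat"
  assumes "mon_deg m = mon_deg n" "\<And>x. Poly_Mapping.lookup m x \<le> Poly_Mapping.lookup n x"
  shows "m = n"
proof (rule poly_mapping_eqI)
  fix x
  show "Poly_Mapping.lookup m x = Poly_Mapping.lookup n x"
  proof (rule ccontr)
    assume "Poly_Mapping.lookup m x \<noteq> Poly_Mapping.lookup n x"
    then have "Poly_Mapping.lookup m x < Poly_Mapping.lookup n x" using assms(2)[of x] by simp
    then have "(\<Sum>x\<in>UNIV. Poly_Mapping.lookup m x) < (\<Sum>x\<in>UNIV. Poly_Mapping.lookup n x)"
      using assms(2) by (intro sum_strict_mono_ex1) auto
    then show False using assms(1) by (simp add: mon_deg_eq_sum_UNIV)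
  qed
qed

text \<open>\<open>N\<close> is the set of non-edges, written in increasing order, of a graph whose vertices are listed in
  a perfect elimination order.\<close>

locale perfect_elimination =
  fixes rank :: "'a::finite \<Rightarrow> nat" and N :: "('a \<times> 'a) set"
  assumes inj_rank: "inj rank"
    and rank_less: "(x, y) \<in> N \<Longrightarrow> rank x < rank y"
    and elimination: "(x, y) \<in> N \<Longrightarrow> rank z < rank x \<Longrightarrow> (z, x) \<in> N \<or> (z, y) \<in> N"
begin

text \<open>Numbers the pairs lexicographically.\<close>

definition code :: "'a \<times> 'a \<Rightarrow> nat" where
  "code e = rank (fst e) * Suc (Max (range rank)) + rank (snd e)"

lemma code_less_iff:
  "code (x, y) < code (a, b) \<longleftrightarrow> rank x < rank a \<or> x = a \<and> rank y < rank b"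
proof -
  let ?R = "Suc (Max (range rank))"
  \<comment> \<open>The base exceeds every rank, so \<open>code\<close> is a two-digit
    expansion.\<close>
  have R: "rank z < ?R" for z by (simp add: less_Suc_eq_le)
  have less: "code (x, y) < code (a, b)" if "rank x < rank a" for x y a b
  proof -
    have "code (x, y) < Suc (rank x) * ?R" using R[of y] by (simp add: code_def)
    also have "\<dots> \<le> rank a * ?R" using that by (intro mult_le_mono1) simp
    also have "\<dots> \<le> code (a, b)" by (simp add: code_def)
    finally show ?thesis .
  qed
  consider "rank x < rank a" | "rank a < rank x" | "x = a"
    using inj_rank by (metis injD linorder_neqE_nat)
  then show ?thesis
  proof cases
    case 1
    then show ?thesis using less by simp
  next
    case 2
    then show ?thesis using less[of a x b y] by auto
  next
    case 3
    then show ?thesis by (simp add: code_def)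
  qed
qed

lemma inj_code: "inj code"
proof (rule injI)
  fix e f assume eq: "code e = code f"
  obtain x y a b where ef: "e = (x, y)" "f = (a, b)" by (cases e, cases f)
  have "rank x = rank a" "rank y = rank b"
    using eq code_less_iff[of x y a b] code_less_iff[of a b x y] unfolding ef by (auto simp: code_def)
  then show "e = f" using inj_rank by (simp add: ef inj_eq)
qed

text \<open>View \<open>J\<close> and \<open>K\<close> as multigraphs and call a vertex excessive if it has larger degree in \<open>K\<close>. A
  maximal alternating trail, starting at an excessive vertex \<open>i\<close> with an edge of \<open>K\<close>, either meets
  \<open>(a, b)\<close>, or ends with an edge of \<open>J\<close> and can be deleted, or ends with an edge of \<open>K\<close> at an
  excessive vertex. In the last case its initial edge has an end preceding \<open>a\<close>, which is not adjacent
  to both \<open>a\<close> and \<open>b\<close>. Only the degree sequences of the two halves \<open>C\<close> and \<open>A\<close> of the trail matter.\<close>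

lemma alternating_exchange:
  assumes "set_mset K \<subseteq> N" "set_mset J \<subseteq> N" "size K = size J" "(a, b) \<in># J"
    and "\<And>e. e \<in># K \<Longrightarrow> code e < code (a, b)"
  shows "\<exists>A C. A \<subseteq># J \<and> (a, b) \<in># A \<and> set_mset C \<subseteq> N \<and> size C = size A \<and>
      (\<forall>e\<in>#C. code e < code (a, b)) \<and>
      (pairs_mon C = pairs_mon A \<or>
       (\<exists>i j. pairs_mon C + mvar j = pairs_mon A + mvar i \<and>
         Poly_Mapping.lookup (pairs_mon J) i < Poly_Mapping.lookup (pairs_mon K) i))"
  using assms
proof (induction "size K" arbitrary: K J rule: less_induct)
  case less
  note KN = less.prems(1) and JN = less.prems(2) and sz = less.prems(3) and F = less.prems(4)
    and K_less = less.prems(5)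
  define exc where "exc i \<longleftrightarrow> Poly_Mapping.lookup (pairs_mon J) i < Poly_Mapping.lookup (pairs_mon K) i" for i
  define good where "good A C \<longleftrightarrow> A \<subseteq># J \<and> (a, b) \<in># A \<and> set_mset C \<subseteq> N \<and> size C = size A \<and>
      (\<forall>e\<in>#C. code e < code (a, b))" for A C
  have goodI: ?case if "good A C" "pairs_mon C + mvar j = pairs_mon A + mvar i" "exc i" for A C i j
    using that unfolding good_def exc_def by blast
  have abN: "(a, b) \<in> N" using F JN by blast
  have ab_mon: "pair_mon (a, b) = mvar a + mvar b" by (simp add: pair_mon_def)
  consider (none) "\<And>i. \<not> exc i" | (low) i where "exc i" "rank i < rank a"
    | (high) i where "exc i" "\<And>i. exc i \<Longrightarrow> rank a \<le> rank i"
    by (meson not_less)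
  then show ?case
  proof cases
    case none
    \<comment> \<open>Without excessive vertices, equal total degree forces equal degree sequences,
      and all of \<open>J\<close> can be replaced by \<open>K\<close>.\<close>
    have "pairs_mon K = pairs_mon J"
      using none sz by (intro lookup_mono_imp_eq) (auto simp: mon_deg_pairs_mon exc_def not_less)
    moreover have "good J K"
      using KN sz F K_less by (auto simp: good_def)
    ultimately show ?thesis unfolding good_def by blast
  next
    case (low i)
    \<comment> \<open>One replacement suffices: \<open>i\<close> precedes \<open>a\<close>, so it
      forms a non-edge with \<open>a\<close> or \<open>b\<close>, smaller than
      \<open>(a, b)\<close>.\<close>
    from elimination[OF abN low(2)] show ?thesis
    proof
      assume "(i, a) \<in> N"
      then have "good {#(a, b)#} {#(i, a)#}" using F low(2) by (simp add: good_def code_less_iff)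
      then show ?thesis by (rule goodI[OF _ _ low(1), where j = b]) (simp add: pair_mon_def add_ac)
    next
      assume "(i, b) \<in> N"
      then have "good {#(a, b)#} {#(i, b)#}" using F low(2) by (simp add: good_def code_less_iff)
      then show ?thesis by (rule goodI[OF _ _ low(1), where j = a]) (simp add: pair_mon_def add_ac)
    qed
  next
    case (high i0)
    \<comment> \<open>Only the degree balance of the trail is recorded: interior vertices cancel,
      while \<open>i0\<close> has a surplus end in \<open>C\<close> and \<open>p\<close> one in
      \<open>A\<close>. Keeping \<open>(a, b)\<close> out of \<open>A\<close> leaves it available to
      be replaced.\<close>
    define trail where "trail = (\<lambda>(C, A, p). C \<subseteq># K \<and> A \<subseteq># J - {#(a, b)#} \<and> size C = size A \<and>
        pairs_mon C + mvar p = pairs_mon A + mvar i0)"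
    have "trail ({#}, {#}, i0)" by (simp add: trail_def)
    moreover have "\<forall>t. trail t \<longrightarrow> size (fst t) < Suc (size K)"
      by (auto simp: trail_def less_Suc_eq_le size_mset_mono)
    ultimately obtain t where t: "trail t" "\<And>t'. trail t' \<Longrightarrow> size (fst t') \<le> size (fst t)"
      using ex_has_greatest_nat[of trail _ "\<lambda>t. size (fst t)" "Suc (size K)"] by metis
    obtain C0 A0 p where "t = (C0, A0, p)" by (cases t)
    with t have C0: "C0 \<subseteq># K" and A0: "A0 \<subseteq># J - {#(a, b)#}" and sz0: "size C0 = size A0"
      and eq0: "pairs_mon C0 + mvar p = pairs_mon A0 + mvar i0"
      and maximal: "\<And>C A q. trail (C, A, q) \<Longrightarrow> size C \<le> size C0"
      by (force simp: trail_def)+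
    have A0J: "A0 \<subseteq># J" using A0 by (metis diff_subset_eq_self subset_mset.order_trans)
    have A0F: "add_mset (a, b) A0 \<subseteq># J"
      using A0 F by (metis insert_DiffM mset_subset_eq_add_mset_cancel)
    show ?thesis
    proof (cases "0 < Poly_Mapping.lookup (pairs_mon (K - C0)) p")
      case True
      then obtain e q where e: "e \<in># K - C0" "pair_mon e = mvar p + mvar q"
        by (rule lookup_pairs_mon_pos)
      define C1 where "C1 = add_mset e C0"
      have "C0 + {#e#} \<subseteq># C0 + (K - C0)" using e(1) by simp
      then have C1: "C1 \<subseteq># K" using C0 by (simp add: C1_def)
      have eq1: "pairs_mon C1 = pairs_mon A0 + mvar i0 + mvar q"
        unfolding C1_def using arg_cong[OF eq0, of "\<lambda>m. m + mvar q"] e(2) by (simp add: ac_simps)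
      have C1N: "set_mset C1 \<subseteq> N" and C1_less: "\<And>e. e \<in># C1 \<Longrightarrow> code e < code (a, b)"
        using C1 KN K_less mset_subset_eqD[OF C1] by auto
      have good1: "good (add_mset (a, b) A0) C1"
        using A0F C1N C1_less sz0 by (simp add: good_def C1_def)
      show ?thesis
      proof (cases "0 < Poly_Mapping.lookup (pairs_mon (J - A0)) q")
        case True
        then obtain h s where h: "h \<in># J - A0" "pair_mon h = mvar q + mvar s"
          by (rule lookup_pairs_mon_pos)
        have eq2: "pairs_mon C1 + mvar s = pairs_mon (add_mset h A0) + mvar i0"
          using eq1 h(2) by (simp add: ac_simps)
        show ?thesis
        proof (cases "h = (a, b)")
          case True
          then show ?thesis using goodI[OF good1 _ high(1)] eq2 by blast
        next
          case False
          have "add_mset h A0 \<subseteq># J - {#(a, b)#}"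
          proof (rule mset_subset_eqI)
            fix f
            show "count (add_mset h A0) f \<le> count (J - {#(a, b)#}) f"
              using mset_subset_eq_count[OF A0, of f] h(1) False
              by (auto simp: in_diff_count split: if_splits)
          qed
          then have "trail (C1, add_mset h A0, s)"
            using C1 sz0 eq2 by (simp add: trail_def C1_def)
          from maximal[OF this] show ?thesis by (simp add: C1_def)
        qed
      next
        case False
        have "Poly_Mapping.lookup (pairs_mon J) q = Poly_Mapping.lookup (pairs_mon A0) q"
          using False by (simp add: pairs_mon_diff[OF A0J] lookup_add)
        also have "\<dots> < Poly_Mapping.lookup (pairs_mon C1) q"
          by (simp add: eq1 lookup_add)
        also have "\<dots> \<le> Poly_Mapping.lookup (pairs_mon K) q"
          by (simp add: pairs_mon_diff[OF C1] lookup_add)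
        finally have q: "exc q" by (simp add: exc_def)
        have "0 < Poly_Mapping.lookup (pairs_mon C1) i0"
          by (simp add: eq1 lookup_add)
        \<comment> \<open>Removing an edge at the start vertex frees its other end
          \<open>p1\<close>. If \<open>p1\<close> precedes \<open>a\<close>, it can be joined anew
          to \<open>a\<close> or \<open>b\<close>.\<close>
        then obtain e1 p1 where e1: "e1 \<in># C1" "pair_mon e1 = mvar i0 + mvar p1"
          "e1 = (i0, p1) \<or> e1 = (p1, i0)"
          by (rule lookup_pairs_mon_pos)
        obtain C2 where C2: "C1 = add_mset e1 C2"
          using e1(1) by (metis insert_DiffM)
        have "(pairs_mon C2 + mvar p1) + mvar i0 = (pairs_mon A0 + mvar q) + mvar i0"
          using eq1 e1(2) unfolding C2 by (simp add: ac_simps)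
        then have eq2: "pairs_mon C2 + mvar p1 = pairs_mon A0 + mvar q" by simp
        note eq3 = arg_cong[OF eq2, of "\<lambda>m. m + mvar a + mvar b"]
        have good2: "good (add_mset (a, b) A0) (add_mset f C2)" if "f \<in> N" "code f < code (a, b)" for f
          using good1 that by (simp add: good_def C2)
        consider "rank p1 < rank a" | "p1 = a" | "rank a < rank p1"
          using inj_rank by (metis injD linorder_neqE_nat)
        then show ?thesis
        proof cases
          case 1
          from elimination[OF abN 1] show ?thesis
          proof
            assume "(p1, a) \<in> N"
            with 1 have "good (add_mset (a, b) A0) (add_mset (p1, a) C2)"
              by (intro good2) (simp_all add: code_less_iff)
            then show ?thesis
              using eq3 by (elim goodI[OF _ _ q, where j = b]) (simp add: pair_mon_def ac_simps)
          next
            assume "(p1, b) \<in> N"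
            with 1 have "good (add_mset (a, b) A0) (add_mset (p1, b) C2)"
              by (intro good2) (simp_all add: code_less_iff)
            then show ?thesis
              using eq3 by (elim goodI[OF _ _ q, where j = a]) (simp add: pair_mon_def ac_simps)
          qed
        next
          case 2
          \<comment> \<open>The edge at \<open>i0\<close> ends in \<open>a\<close>, so it alone
            replaces \<open>(a, b)\<close>, trading \<open>b\<close> for \<open>i0\<close>.\<close>
          have "good {#(a, b)#} {#e1#}"
            using F e1(1) C1N C1_less by (auto simp: good_def)
          then show ?thesis
            by (rule goodI[where i = i0 and j = b]) (simp_all add: e1(2) 2 ab_mon high(1) ac_simps)
        next
          case 3
          \<comment> \<open>No end of \<open>e1\<close> precedes \<open>a\<close>, yet
            \<open>e1\<close> is smaller than \<open>(a, b)\<close>, so it starts at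
            \<open>a\<close>; as \<open>p1\<close> lies later, that end is
            \<open>i0\<close>.\<close>
          have "i0 = a"
            using C1_less[OF e1(1)] e1(3) high(2)[OF high(1)] 3 by (auto simp: code_less_iff)
          then show ?thesis
            using eq1 by (intro goodI[OF good1 _ q, where j = b]) (simp add: ab_mon ac_simps)
        qed
      qed
    next
      case False
      \<comment> \<open>The trail is deleted without creating excessive vertices: \<open>C0\<close>
        and \<open>A0\<close> have equal degrees away from \<open>i0\<close> and \<open>p\<close>,
        the deletion lowers the excess at \<open>i0\<close>, and no edge of \<open>K\<close> remains
        at \<open>p\<close>.\<close>
      have Kp: "Poly_Mapping.lookup (pairs_mon K) p = Poly_Mapping.lookup (pairs_mon C0) p"
        using False by (simp add: pairs_mon_diff[OF C0] lookup_add)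
      have lookup0: "Poly_Mapping.lookup (pairs_mon C0) x + (if x = p then 1 else 0) =
          Poly_Mapping.lookup (pairs_mon A0) x + (if x = i0 then 1 else 0)" for x
        using arg_cong[OF eq0, of "\<lambda>m. Poly_Mapping.lookup m x"]
        by (auto simp: lookup_add lookup_single when_def split: if_splits)
      have lookupK: "Poly_Mapping.lookup (pairs_mon K) x =
          Poly_Mapping.lookup (pairs_mon C0) x + Poly_Mapping.lookup (pairs_mon (K - C0)) x" for x
        by (simp add: pairs_mon_diff[OF C0] lookup_add)
      have lookupJ: "Poly_Mapping.lookup (pairs_mon J) x =
          Poly_Mapping.lookup (pairs_mon A0) x + Poly_Mapping.lookup (pairs_mon (J - A0)) x" for x
        by (simp add: pairs_mon_diff[OF A0J] lookup_add)
      have p: "p \<noteq> i0"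
        using high(1) Kp lookup0[of p] lookupJ[of p] by (auto simp: exc_def)
      have exc': "exc i" if "Poly_Mapping.lookup (pairs_mon (J - A0)) i < Poly_Mapping.lookup (pairs_mon (K - C0)) i" for i
        using that lookup0[of i] lookupK[of i] lookupJ[of i] False p by (auto simp: exc_def split: if_splits)
      have "C0 \<noteq> {#}"
      proof
        assume "C0 = {#}"
        then show False using lookup0[of p] sz0 p by simp
      qed
      then have small: "size (K - C0) < size K"
        using C0 size_mset_mono[OF C0] by (simp add: size_Diff_submset nonempty_has_size)
      have "\<exists>A C. A \<subseteq># J - A0 \<and> (a, b) \<in># A \<and> set_mset C \<subseteq> N \<and> size C = size A \<and>
          (\<forall>e\<in>#C. code e < code (a, b)) \<and>
          (pairs_mon C = pairs_mon A \<or>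
           (\<exists>i j. pairs_mon C + mvar j = pairs_mon A + mvar i \<and>
             Poly_Mapping.lookup (pairs_mon (J - A0)) i < Poly_Mapping.lookup (pairs_mon (K - C0)) i))"
      proof (rule less.hyps[OF small])
        show "set_mset (K - C0) \<subseteq> N" "set_mset (J - A0) \<subseteq> N"
          using KN JN by (auto dest: in_diffD)
        show "size (K - C0) = size (J - A0)"
          using C0 A0J sz sz0 by (simp add: size_Diff_submset)
        show "(a, b) \<in># J - A0"
          using mset_subset_eq_count[OF A0F, of "(a, b)"] by (simp add: in_diff_count)
        show "code e < code (a, b)" if "e \<in># K - C0" for e
          by (rule K_less[OF in_diffD[OF that]])
      qed
      then obtain A C where AC: "A \<subseteq># J - A0" "(a, b) \<in># A" "set_mset C \<subseteq> N" "size C = size A"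
        "\<forall>e\<in>#C. code e < code (a, b)" and alt: "pairs_mon C = pairs_mon A \<or>
           (\<exists>i j. pairs_mon C + mvar j = pairs_mon A + mvar i \<and>
             Poly_Mapping.lookup (pairs_mon (J - A0)) i < Poly_Mapping.lookup (pairs_mon (K - C0)) i)"
        by blast
      have "good A C"
        using AC unfolding good_def by (metis diff_subset_eq_self subset_mset.order_trans)
      then show ?thesis
        using alt exc' unfolding good_def exc_def by blast
    qed
  qed
qed

end

section \<open>Ordering the generators\<close>

lemma mset_add_diff_commute: "W + (V - W) = V + (W - V :: 'b multiset)"
  by (rule multiset_eqI) simp

lemma size_diff_commute_eq:
  fixes V W :: "'b multiset"
  assumes "size V = size W"
  shows "size (V - W) = size (W - V)"
  using assms arg_cong[OF mset_add_diff_commute[of W V], of size] by simp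

lemma finite_bounded_monomials:
  fixes k :: nat
  shows "finite {m :: 'a::finite \<Rightarrow>\<^sub>0 nat. \<forall>x. Poly_Mapping.lookup m x \<le> k}"
proof (rule finite_imageD)
  have "Poly_Mapping.lookup ` {m :: 'a \<Rightarrow>\<^sub>0 nat. \<forall>x. Poly_Mapping.lookup m x \<le> k} \<subseteq>
      {f. \<forall>x. (x \<in> UNIV \<longrightarrow> f x \<in> {..k}) \<and> (x \<notin> UNIV \<longrightarrow> f x = 0)}" by auto
  moreover have "finite {f :: 'a \<Rightarrow> nat. \<forall>x. (x \<in> UNIV \<longrightarrow> f x \<in> {..k}) \<and> (x \<notin> UNIV \<longrightarrow> f x = 0)}"
    by (rule finite_set_of_finite_funs) simp_all
  ultimately show "finite (Poly_Mapping.lookup ` {m :: 'a \<Rightarrow>\<^sub>0 nat. \<forall>x. Poly_Mapping.lookup m x \<le> k})"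
    by (rule finite_subset)
qed (simp add: inj_on_def lookup_inject)

text \<open>Equal degrees allow a constant to be subtracted from all weights. Take the largest
  weight \<open>t\<close> of a variable where \<open>m\<close> is ahead: if the claim failed, every
  variable where \<open>n\<close> is ahead would weigh more than \<open>t\<close>, giving
  \<open>n\<close> the larger weighted sum.\<close>

lemma weighted_sum_exchange:
  fixes m n :: "'a::finite \<Rightarrow>\<^sub>0 nat" and c :: "'a \<Rightarrow> nat"
  assumes "inj c" "mon_deg m = mon_deg n" "m \<noteq> n"
    and le: "(\<Sum>x\<in>UNIV. c x * Poly_Mapping.lookup n x) \<le> (\<Sum>x\<in>UNIV. c x * Poly_Mapping.lookup m x)"
  shows "\<exists>x y. Poly_Mapping.lookup m x < Poly_Mapping.lookup n x \<and>
    Poly_Mapping.lookup n y < Poly_Mapping.lookup m y \<and> c x < c y"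
proof (rule ccontr)
  assume contra: "\<not> ?thesis"
  define Y where "Y = {y. Poly_Mapping.lookup n y < Poly_Mapping.lookup m y}"
  define d where "d x = int (Poly_Mapping.lookup n x) - int (Poly_Mapping.lookup m x)" for x
  define t where "t = Max (c ` Y)"
  obtain x0 where x0: "Poly_Mapping.lookup m x0 < Poly_Mapping.lookup n x0"
    using lookup_mono_imp_eq[of n m] assms(2,3) by (metis not_less)
  obtain y0 where y0: "y0 \<in> Y"
    using lookup_mono_imp_eq[of m n] assms(2,3) by (auto simp: Y_def) (metis not_less)
  have "t \<in> c ` Y" unfolding t_def using y0 by (intro Max_in) auto
  then obtain y1 where y1: "y1 \<in> Y" "t = c y1" by blast
  have t_max: "c y \<le> t" if "y \<in> Y" for y unfolding t_def using that by (intro Max_ge) auto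
  have above: "t < c x" if x: "Poly_Mapping.lookup m x < Poly_Mapping.lookup n x" for x
  proof -
    have "x \<noteq> y1" using x y1(1) by (auto simp: Y_def)
    then have "c x \<noteq> c y1" using assms(1) by (auto dest: injD)
    moreover have "\<not> c x < c y1" using contra x y1(1) by (auto simp: Y_def)
    ultimately show ?thesis by (simp add: y1(2))
  qed
  have "0 < (\<Sum>x\<in>UNIV. (int (c x) - int t) * d x)"
  proof (rule sum_pos2[of _ x0])
    show "0 < (int (c x0) - int t) * d x0"
      using above[OF x0] x0 by (simp add: d_def)
    show "0 \<le> (int (c x) - int t) * d x" for x
    proof (cases "Poly_Mapping.lookup m x < Poly_Mapping.lookup n x")
      case True
      then show ?thesis using above[OF True] by (simp add: d_def)
    next
      case False
      show ?thesis
      proof (cases "x \<in> Y")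
        case True
        then show ?thesis using t_max[OF True] False by (intro mult_nonpos_nonpos) (auto simp: d_def)
      next
        case False': False
        then have "d x = 0" using False by (simp add: d_def Y_def)
        then show ?thesis by simp
      qed
    qed
  qed simp_all
  also have "(\<Sum>x\<in>UNIV. (int (c x) - int t) * d x) =
      (\<Sum>x\<in>UNIV. int (c x) * d x) - int t * (\<Sum>x\<in>UNIV. d x)"
    by (simp add: left_diff_distrib sum_subtractf sum_distrib_left)
  also have "(\<Sum>x\<in>UNIV. d x) = int (mon_deg n) - int (mon_deg m)"
    by (simp add: d_def mon_deg_eq_sum_UNIV sum_subtractf)
  also have "(\<Sum>x\<in>UNIV. int (c x) * d x) =
      int (\<Sum>x\<in>UNIV. c x * Poly_Mapping.lookup n x) - int (\<Sum>x\<in>UNIV. c x * Poly_Mapping.lookup m x)"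
    by (simp add: d_def right_diff_distrib sum_subtractf)
  finally show False
    using le unfolding assms(2) by (simp only: diff_self mult_zero_right)
qed

section \<open>Least factors and the exchange of generators\<close>

context perfect_elimination
begin

text \<open>Numbers the multisets of at most \<open>k\<close> pairs according to the multiset extension of the
  lexicographic order.\<close>

definition weight :: "nat \<Rightarrow> ('a \<times> 'a) multiset \<Rightarrow> nat" where
  "weight k W = (\<Sum>e\<in>#W. Suc k ^ code e)"

lemma weight_simps [simp]:
  "weight k (add_mset e W) = Suc k ^ code e + weight k W"
  "weight k (V + W) = weight k V + weight k W"
  by (simp_all add: weight_def)

text \<open>There are at most \<open>k\<close> summands, each at most a \<open>Suc k\<close>-th part
  of \<open>Suc k ^ n\<close>. Multiplying through by \<open>Suc k\<close> avoids the exponent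
  \<open>n - 1\<close>.\<close>

lemma weight_less_power:
  assumes "size C \<le> k" "\<And>e. e \<in># C \<Longrightarrow> code e < n"
  shows "weight k C < Suc k ^ n"
proof -
  have "Suc k * weight k C \<le> size C * Suc k ^ n"
    using assms(2)
  proof (induction C)
    case empty
    show ?case by (simp add: weight_def)
  next
    case (add e C)
    have "Suc k * Suc k ^ code e \<le> Suc k ^ n"
      using add.prems[of e] power_increasing[of "Suc (code e)" n "Suc k"] by simp
    moreover have "Suc k * weight k C \<le> size C * Suc k ^ n" using add by simp
    ultimately show ?case by (simp add: algebra_simps)
  qed
  also have "\<dots> \<le> k * Suc k ^ n" using assms(1) by (rule mult_le_mono1)
  also have "\<dots> < Suc k * Suc k ^ n" by simp
  finally show ?thesis by (simp only: mult_less_cancel1)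
qed

lemma power_code_le_weight: "e \<in># W \<Longrightarrow> Suc k ^ code e \<le> weight k W"
  using multi_member_split[of e W] by auto

definition pair_factor :: "nat \<Rightarrow> ('a \<Rightarrow>\<^sub>0 nat) \<Rightarrow> ('a \<times> 'a) multiset \<Rightarrow> bool" where
  "pair_factor k m W \<longleftrightarrow> set_mset W \<subseteq> N \<and> size W = k \<and> (\<exists>w. m = pairs_mon W + w)"

text \<open>For \<open>d = r * k\<close> an intrinsic description of the generators, free of any
  factorization into sets; \<open>nonedge_set_products\<close> identifies the two.\<close>

definition bounded_multiples :: "nat \<Rightarrow> nat \<Rightarrow> ('a \<Rightarrow>\<^sub>0 nat) set" where
  "bounded_multiples d k = {m. mon_deg m = d \<and> (\<forall>x. Poly_Mapping.lookup m x \<le> k) \<and> (\<exists>W. pair_factor k m W)}"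

definition least_weight :: "nat \<Rightarrow> ('a \<Rightarrow>\<^sub>0 nat) \<Rightarrow> nat" where
  "least_weight k m = (LEAST c. \<exists>W. pair_factor k m W \<and> weight k W = c)"

text \<open>Pairs are compared lexicographically. Ranks are pairwise distinct weights, so exchanging
  one variable for another always changes the second component.\<close>

definition key :: "nat \<Rightarrow> ('a \<Rightarrow>\<^sub>0 nat) \<Rightarrow> nat \<times> nat" where
  "key k m = (least_weight k m, \<Sum>x\<in>UNIV. rank x * Poly_Mapping.lookup m x)"

lemma least_weight_le: "pair_factor k m W \<Longrightarrow> least_weight k m \<le> weight k W"
  unfolding least_weight_def by (rule Least_le) blast

lemma least_weight_attained:
  assumes "m \<in> bounded_multiples d k"
  obtains W where "pair_factor k m W" "weight k W = least_weight k m"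
proof -
  have "\<exists>c W. pair_factor k m W \<and> weight k W = c"
    using assms by (auto simp: bounded_multiples_def)
  from LeastI_ex[OF this] show ?thesis
    using that unfolding least_weight_def by blast
qed

text \<open>Only the exponent of \<open>x\<close> can grow, by one, and it does not pass that of
  \<open>m'\<close>; hence the bound \<open>k\<close> survives.\<close>

lemma bounded_multiples_exchange:
  assumes "m \<in> bounded_multiples d k" "m' \<in> bounded_multiples d k" "pair_factor k m'' W"
    and "m'' + mvar y = m + mvar x" "Poly_Mapping.lookup m x < Poly_Mapping.lookup m' x"
  shows "m'' \<in> bounded_multiples d k"
proof -
  have "mon_deg m'' = mon_deg m"
    using arg_cong[OF assms(4), of mon_deg] by (simp add: mon_deg_add mon_deg_def[of "mvar _"])
  moreover have "Poly_Mapping.lookup m'' z \<le> k" for z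
  proof -
    have "Poly_Mapping.lookup m'' z \<le> Poly_Mapping.lookup m z + (if z = x then 1 else 0)"
      using arg_cong[OF assms(4), of "\<lambda>m. Poly_Mapping.lookup m z"]
      by (auto simp: lookup_add lookup_single when_def split: if_splits)
    also have "\<dots> \<le> max (Poly_Mapping.lookup m z) (Poly_Mapping.lookup m' z)"
      using assms(5) by auto
    also have "\<dots> \<le> k" using assms(1,2) by (simp add: bounded_multiples_def)
    finally show ?thesis .
  qed
  ultimately show ?thesis
    using assms(1,3) by (auto simp: bounded_multiples_def)
qed

text \<open>Take \<open>f\<close> of largest code in \<open>W - V\<close>. A pair of
  \<open>V - W\<close> with larger code would alone outweigh \<open>W - V\<close>, making
  \<open>V\<close> heavier than \<open>W\<close>.\<close>

lemma exists_larger_pair: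
  assumes "size V = k" "size W = k" "V \<noteq> W" "weight k V \<le> weight k W"
  shows "\<exists>f\<in>#W - V. \<forall>e\<in>#V - W. code e < code f"
proof -
  have sz: "size (V - W) = size (W - V)" using assms(1,2) by (simp add: size_diff_commute_eq)
  have "W - V \<noteq> {#}"
  proof
    assume "W - V = {#}"
    then have "V - W = {#}" using sz by simp
    with \<open>W - V = {#}\<close> have "V = W" by (simp add: Diff_eq_empty_iff_mset subset_mset.order_antisym)
    then show False using assms(3) by simp
  qed
  then have "Max (code ` set_mset (W - V)) \<in> code ` set_mset (W - V)"
    by (intro Max_in) auto
  then obtain f where f: "f \<in># W - V" "code f = Max (code ` set_mset (W - V))" by auto
  have f_max: "code g \<le> code f" if "g \<in># W - V" for g
    unfolding f(2) using that by (intro Max_ge) auto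
  have "code e < code f" if e: "e \<in># V - W" for e
  proof (rule ccontr)
    assume "\<not> code e < code f"
    moreover have "e \<noteq> f" using e f(1) by (auto simp: in_diff_count)
    then have "code e \<noteq> code f" using inj_code by (auto dest: injD)
    ultimately have "code f < code e" by simp
    then have "weight k (W - V) < Suc k ^ code e"
      using f_max assms(2) size_mset_mono[of "W - V" W]
      by (intro weight_less_power) (auto intro: le_less_trans simp: diff_subset_eq_self)
    also have "\<dots> \<le> weight k (V - W)" using e by (rule power_code_le_weight)
    finally have "weight k (W - V) < weight k (V - W)" .
    moreover have "weight k W + weight k (V - W) = weight k V + weight k (W - V)"
      using arg_cong[OF mset_add_diff_commute[of W V], of "weight k"] by simp
    ultimately show False using assms(4) by simp
  qed
  then show ?thesis using f(1) by blast
qed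

lemma key_exchange:
  assumes m: "m \<in> bounded_multiples d k" and m': "m' \<in> bounded_multiples d k"
    and "m \<noteq> m'" and key_le: "key k m' \<le> key k m"
  shows "\<exists>x y. \<exists>m''\<in>bounded_multiples d k. Poly_Mapping.lookup m x < Poly_Mapping.lookup m' x \<and>
    m'' + mvar y = m + mvar x \<and> key k m'' < key k m"
proof -
  obtain W where W: "pair_factor k m W" "weight k W = least_weight k m"
    using m by (rule least_weight_attained)
  then have WN: "set_mset W \<subseteq> N" and Wk: "size W = k" by (simp_all add: pair_factor_def)
  obtain V where V: "pair_factor k m' V" "weight k V = least_weight k m'"
    using m' by (rule least_weight_attained)
  obtain w where w: "m = pairs_mon W + w" using W(1) by (auto simp: pair_factor_def)
  obtain v where v: "m' = pairs_mon V + v" using V(1) by (auto simp: pair_factor_def)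
  show ?thesis
  proof (cases "V = W")
    case True
    have "(\<Sum>x\<in>UNIV. rank x * Poly_Mapping.lookup m' x) \<le> (\<Sum>x\<in>UNIV. rank x * Poly_Mapping.lookup m x)"
      using key_le True V(2) W(2) by (simp add: key_def)
    moreover have "mon_deg m = mon_deg m'" using m m' by (simp add: bounded_multiples_def)
    ultimately obtain x y where xy: "Poly_Mapping.lookup m x < Poly_Mapping.lookup m' x"
      "Poly_Mapping.lookup m' y < Poly_Mapping.lookup m y" "rank x < rank y"
      using weighted_sum_exchange[OF inj_rank, of m m'] \<open>m \<noteq> m'\<close> by blast
    \<comment> \<open>Both monomials contain the factor \<open>W\<close>, so the surplus of
      \<open>m\<close> at \<open>y\<close> sits in the cofactor, where \<open>y\<close> can be
      traded for \<open>x\<close> without touching \<open>W\<close>.\<close>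
    have "0 < Poly_Mapping.lookup w y"
      using xy(2) by (simp add: v w True lookup_add)
    then obtain w1 where w1: "w = w1 + mvar y" using mvar_dvd_imp[of w y] by blast
    define m'' where "m'' = pairs_mon W + (w1 + mvar x)"
    have pf: "pair_factor k m'' W"
      using W(1) by (auto simp: pair_factor_def m''_def)
    have eq: "m'' + mvar y = m + mvar x" by (simp add: m''_def w w1 ac_simps)
    have "m'' \<in> bounded_multiples d k"
      using m m' pf eq xy(1) by (rule bounded_multiples_exchange)
    moreover have "key k m'' < key k m"
    proof -
      have lin: "(\<Sum>z\<in>UNIV. rank z * Poly_Mapping.lookup (n + mvar u) z) =
          (\<Sum>z\<in>UNIV. rank z * Poly_Mapping.lookup n z) + rank u" for n u
      proof -
        have "(\<Sum>z\<in>UNIV. rank z * Poly_Mapping.lookup (n + mvar u) z) =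
            (\<Sum>z\<in>UNIV. rank z * Poly_Mapping.lookup n z + (if z = u then rank u else 0))"
          by (rule sum.cong) (auto simp: lookup_add lookup_single when_def algebra_simps)
        then show ?thesis by (simp add: sum.distrib)
      qed
      have "(\<Sum>z\<in>UNIV. rank z * Poly_Mapping.lookup m'' z) < (\<Sum>z\<in>UNIV. rank z * Poly_Mapping.lookup m z)"
        using lin[of m'' y] lin[of m x] eq xy(3) by simp
      moreover have "least_weight k m'' \<le> least_weight k m"
        using least_weight_le[OF pf] W(2) by simp
      ultimately show ?thesis by (auto simp: key_def)
    qed
    ultimately show ?thesis using xy(1) eq by blast
  next
    case False
    have "weight k V \<le> weight k W"
      using key_le V(2) W(2) by (auto simp: key_def)
    then obtain f where f: "f \<in># W - V" "\<forall>e\<in>#V - W. code e < code f"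
      using exists_larger_pair[OF _ _ False, of k] V(1) W(1) by (auto simp: pair_factor_def)
    obtain a b where ab: "f = (a, b)" by (cases f)
    have "\<exists>A C. A \<subseteq># W - V \<and> (a, b) \<in># A \<and> set_mset C \<subseteq> N \<and> size C = size A \<and>
      (\<forall>e\<in>#C. code e < code (a, b)) \<and>
      (pairs_mon C = pairs_mon A \<or>
       (\<exists>i j. pairs_mon C + mvar j = pairs_mon A + mvar i \<and>
         Poly_Mapping.lookup (pairs_mon (W - V)) i < Poly_Mapping.lookup (pairs_mon (V - W)) i))"
    proof (rule alternating_exchange)
      show "set_mset (V - W) \<subseteq> N" "set_mset (W - V) \<subseteq> N"
        using V(1) W(1) by (auto simp: pair_factor_def dest: in_diffD)
      show "size (V - W) = size (W - V)"
        using V(1) W(1) by (simp add: pair_factor_def size_diff_commute_eq)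
      show "(a, b) \<in># W - V" using f(1) ab by simp
      show "code e < code (a, b)" if "e \<in># V - W" for e using f(2) ab that by blast
    qed
    then obtain A C where A: "A \<subseteq># W - V" "(a, b) \<in># A" and C: "set_mset C \<subseteq> N" "size C = size A"
      "\<forall>e\<in>#C. code e < code (a, b)"
      and alt: "pairs_mon C = pairs_mon A \<or>
       (\<exists>i j. pairs_mon C + mvar j = pairs_mon A + mvar i \<and>
         Poly_Mapping.lookup (pairs_mon (W - V)) i < Poly_Mapping.lookup (pairs_mon (V - W)) i)"
      by blast
    have AW: "A \<subseteq># W" using A(1) by (metis diff_subset_eq_self subset_mset.order_trans)
    \<comment> \<open>Since \<open>(a, b)\<close> alone outweighs \<open>C\<close>, this multiset is
      lighter than \<open>W\<close> and by minimality cannot divide \<open>m\<close>; so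
      \<open>C\<close> and \<open>A\<close> have different products.\<close>
    define W' where "W' = (W - A) + C"
    have W'N: "set_mset W' \<subseteq> N"
      using WN C(1) by (auto simp: W'_def dest: in_diffD)
    have W'k: "size W' = k"
      unfolding W'_def size_union size_Diff_submset[OF AW] using size_mset_mono[OF AW] C(2) Wk by simp
    have "weight k C < Suc k ^ code (a, b)"
    proof (rule weight_less_power)
      show "size C \<le> k" using C(2) size_mset_mono[OF AW] Wk by simp
      show "code e < code (a, b)" if "e \<in># C" for e using C(3) that by blast
    qed
    also have "\<dots> \<le> weight k A" using A(2) by (rule power_code_le_weight)
    finally have "weight k W' < weight k ((W - A) + A)" by (simp add: W'_def)
    then have W'_less: "weight k W' < least_weight k m" using AW W(2) by simp
    have not_factor: "\<not> pair_factor k m W'"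
      using least_weight_le[of k m W'] W'_less by linarith
    have W_mon: "pairs_mon W = pairs_mon A + pairs_mon (W - A)" using AW by (rule pairs_mon_diff)
    have "pairs_mon C \<noteq> pairs_mon A"
    proof
      assume "pairs_mon C = pairs_mon A"
      then have "m = pairs_mon W' + w" by (simp add: w W_mon W'_def ac_simps)
      then show False using not_factor W'N W'k by (auto simp: pair_factor_def)
    qed
    with alt obtain i j where ij: "pairs_mon C + mvar j = pairs_mon A + mvar i"
      "Poly_Mapping.lookup (pairs_mon (W - V)) i < Poly_Mapping.lookup (pairs_mon (V - W)) i"
      by blast
    have W'_mon: "pairs_mon W' + mvar j = pairs_mon W + mvar i"
      using arg_cong[OF ij(1), of "\<lambda>n. n + pairs_mon (W - A)"] by (simp add: W'_def W_mon ac_simps)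
    \<comment> \<open>If \<open>i\<close> divided \<open>w\<close>, the missing \<open>i\<close>
      could be taken from there and \<open>W'\<close> would divide \<open>m\<close>. Hence
      \<open>m\<close> has the same exponent at \<open>i\<close> as \<open>W\<close>, less than that
      of \<open>V\<close>.\<close>
    have "Poly_Mapping.lookup w i = 0"
    proof (rule ccontr)
      assume "Poly_Mapping.lookup w i \<noteq> 0"
      then obtain w1 where "w = w1 + mvar i" using mvar_dvd_imp[of w i] by auto
      then have "m = pairs_mon W' + (mvar j + w1)"
        using arg_cong[OF W'_mon, of "\<lambda>n. n + w1"] by (simp add: w ac_simps)
      then show False using not_factor W'N W'k by (auto simp: pair_factor_def)
    qed
    moreover have "Poly_Mapping.lookup (pairs_mon W) i < Poly_Mapping.lookup (pairs_mon V) i"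
      using arg_cong[OF mset_add_diff_commute[of W V], of "\<lambda>U. Poly_Mapping.lookup (pairs_mon U) i"] ij(2)
      by (simp add: lookup_add)
    ultimately have mi: "Poly_Mapping.lookup m i < Poly_Mapping.lookup m' i"
      by (simp add: w v lookup_add)
    have pf: "pair_factor k (pairs_mon W' + w) W'"
      using W'N W'k by (auto simp: pair_factor_def)
    have eq: "(pairs_mon W' + w) + mvar j = m + mvar i"
      using arg_cong[OF W'_mon, of "\<lambda>n. n + w"] by (simp add: w ac_simps)
    have "pairs_mon W' + w \<in> bounded_multiples d k"
      using m m' pf eq mi by (rule bounded_multiples_exchange)
    moreover have "key k (pairs_mon W' + w) < key k m"
      using least_weight_le[OF pf] W'_less by (auto simp: key_def)
    ultimately show ?thesis using mi eq by blast
  qed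
qed

lemma finite_bounded_multiples: "finite (bounded_multiples d k)"
  by (rule finite_subset[OF _ finite_bounded_monomials[of k]]) (auto simp: bounded_multiples_def)

end

section \<open>Products of sets containing a non-edge\<close>

lemma mon_deg_set_mon:
  fixes F :: "'a::finite set"
  shows "mon_deg (set_mon F) = card F"
  by (simp add: set_mon_def mon_deg_sum mon_deg_def[of "mvar _"])

lemma set_mon_insert:
  fixes F :: "'a::finite set"
  assumes "x \<notin> F"
  shows "set_mon (insert x F) = mvar x + set_mon F"
  using assms by (simp add: set_mon_def)

lemma set_mon_remove:
  fixes F :: "'a::finite set"
  assumes "x \<in> F"
  shows "set_mon F = mvar x + set_mon (F - {x})"
  using set_mon_insert[of x "F - {x}"] assms by (simp add: insert_absorb)

context perfect_elimination
begin

definition has_nonedge :: "'a set \<Rightarrow> bool" where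
  "has_nonedge F \<longleftrightarrow> (\<exists>x y. (x, y) \<in> N \<and> x \<in> F \<and> y \<in> F)"

lemma has_nonedge_mono: "has_nonedge F \<Longrightarrow> F \<subseteq> G \<Longrightarrow> has_nonedge G"
  unfolding has_nonedge_def by blast

text \<open>If the chosen non-edge of \<open>G\<close> lies in \<open>F\<close>, any element of
  \<open>F - G\<close> may go. Otherwise \<open>G - F\<close> is nonempty, so the gap of two gives
  \<open>F - G\<close> three elements, one of which avoids the chosen non-edge of
  \<open>F\<close>.\<close>

lemma has_nonedge_transfer:
  assumes "has_nonedge F" "has_nonedge G" "card G + 2 \<le> card F"
  shows "\<exists>x\<in>F - G. has_nonedge (F - {x})"
proof -
  obtain c d where cd: "(c, d) \<in> N" "c \<in> G" "d \<in> G" using assms(2) by (auto simp: has_nonedge_def)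
  obtain u v where uv: "(u, v) \<in> N" "u \<in> F" "v \<in> F" using assms(1) by (auto simp: has_nonedge_def)
  have FG: "card (F - G) + card (F \<inter> G) = card F"
    by (metis Diff_Int2 Int_Diff_disjoint Un_Diff_Int card_Un_disjoint finite inf_commute add.commute)
  have GF: "card (G - F) + card (F \<inter> G) = card G"
    by (metis Diff_Int2 Int_Diff_disjoint Un_Diff_Int card_Un_disjoint finite inf_commute add.commute)
  show ?thesis
  proof (cases "c \<in> F \<and> d \<in> F")
    case True
    have "0 < card (F - G)" using FG GF assms(3) by linarith
    then have "F - G \<noteq> {}" by (auto simp: card_gt_0_iff)
    then obtain x where x: "x \<in> F - G" by blast
    then have "has_nonedge (F - {x})" using True cd by (auto simp: has_nonedge_def)
    then show ?thesis using x by blast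
  next
    case False
    then have "G - F \<noteq> {}" using cd by blast
    then have "1 \<le> card (G - F)" by (simp add: Suc_le_eq card_gt_0_iff)
    then have "3 \<le> card (F - G)" using FG GF assms(3) by simp
    moreover have "card {u, v} \<le> 2" by (simp add: card_insert_if)
    ultimately have "\<not> F - G \<subseteq> {u, v}" using card_mono[of "{u, v}" "F - G"] by auto
    then obtain x where x: "x \<in> F - G" "x \<notin> {u, v}" by blast
    then have "has_nonedge (F - {x})" using uv by (auto simp: has_nonedge_def)
    then show ?thesis using x(1) by blast
  qed
qed

text \<open>While \<open>x\<close> is left in \<open>w\<close>, the exponent bound forces one of the
  \<open>k\<close> sets to miss \<open>x\<close>, and \<open>x\<close> is inserted there.\<close>

lemma distribute_monomial:
  assumes "\<And>i. i < k \<Longrightarrow> has_nonedge (F i)"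
    and "\<And>x. Poly_Mapping.lookup ((\<Sum>i<k. set_mon (F i)) + w) x \<le> k"
  shows "\<exists>G. (\<forall>i<k. has_nonedge (G i)) \<and> (\<Sum>i<k. set_mon (G i)) = (\<Sum>i<k. set_mon (F i)) + w"
  using assms
proof (induction "mon_deg w" arbitrary: F w)
  case 0
  then have "w = 0"
    using lookup_mono_imp_eq[of 0 w] by (simp add: mon_deg_def)
  then show ?case using 0 by auto
next
  case (Suc n)
  have "\<exists>x. 0 < Poly_Mapping.lookup w x"
    using Suc.hyps(2) by (metis gr_zeroI mon_deg_eq_sum_UNIV sum.neutral nat.distinct(1))
  then obtain x where "0 < Poly_Mapping.lookup w x" by blast
  then obtain w1 where w1: "w = w1 + mvar x" using mvar_dvd_imp[of w x] by blast
  have "\<exists>i<k. x \<notin> F i"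
  proof (rule ccontr)
    assume "\<not> (\<exists>i<k. x \<notin> F i)"
    then have "Poly_Mapping.lookup (\<Sum>i<k. set_mon (F i)) x = k"
      by (simp add: lookup_sum lookup_set_mon)
    then show False using Suc.prems(2)[of x] by (simp add: w1 lookup_add)
  qed
  then obtain i where i: "i < k" "x \<notin> F i" by blast
  define F' where "F' = F(i := insert x (F i))"
  have sum_F': "(\<Sum>j<k. set_mon (F' j)) = (\<Sum>j<k. set_mon (F j)) + mvar x"
  proof -
    have "(\<Sum>j<k. set_mon (F' j)) = (\<Sum>j<k. set_mon (F j) + (if j = i then mvar x else 0))"
      using i(2) by (intro sum.cong) (auto simp: F'_def set_mon_insert add.commute)
    then show ?thesis using i(1) by (simp add: sum.distrib)
  qed
  have "has_nonedge (F' j)" if "j < k" for j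
    using Suc.prems(1)[OF that] has_nonedge_mono[of "F i" "insert x (F i)"] by (auto simp: F'_def)
  moreover have "(\<Sum>j<k. set_mon (F' j)) + w1 = (\<Sum>j<k. set_mon (F j)) + w"
    by (simp add: sum_F' w1 ac_simps)
  moreover have "n = mon_deg w1"
    using Suc.hyps(2) by (simp add: w1 mon_deg_add mon_deg_def[of "mvar _"])
  ultimately show ?case using Suc.hyps(1)[of w1 F'] Suc.prems(2) by simp
qed

text \<open>Moving an element from a set larger than \<open>r\<close> to one smaller than
  \<open>r\<close> keeps the product and lowers the sum of squared sizes. The two sizes differ by at
  least two, as the transfer requires.\<close>

lemma balance_sets:
  assumes "\<And>i. i < k \<Longrightarrow> has_nonedge (F i)" "(\<Sum>i<k. card (F i)) = r * k"
  shows "\<exists>G. (\<forall>i<k. card (G i) = r \<and> has_nonedge (G i)) \<and> (\<Sum>i<k. set_mon (G i)) = (\<Sum>i<k. set_mon (F i))"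
  using assms
proof (induction "\<Sum>i<k. card (F i) ^ 2" arbitrary: F rule: less_induct)
  case less
  show ?case
  proof (cases "\<forall>i<k. card (F i) = r")
    case True
    then show ?thesis using less.prems(1) by blast
  next
    case False
    have "\<exists>i<k. r < card (F i)"
    proof (rule ccontr)
      assume "\<not> ?thesis"
      then have le: "card (F i) \<le> r" if "i < k" for i using that by (meson not_less)
      obtain i where i: "i < k" "card (F i) \<noteq> r" using False by blast
      then have "card (F i) < r" using le[of i] by simp
      then have "(\<Sum>i<k. card (F i)) < (\<Sum>i<k. r)"
        using le i(1) by (intro sum_strict_mono_ex1) auto
      then show False using less.prems(2) by (simp add: mult.commute)
    qed
    then obtain i where i: "i < k" "r < card (F i)" by blast
    have "\<exists>j<k. card (F j) < r"
    proof (rule ccontr)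
      assume "\<not> ?thesis"
      then have "r \<le> card (F i)" if "i < k" for i using that by (meson not_less)
      then have "(\<Sum>i<k. r) < (\<Sum>i<k. card (F i))"
        using i by (intro sum_strict_mono_ex1) auto
      then show False using less.prems(2) by (simp add: mult.commute)
    qed
    then obtain j where j: "j < k" "card (F j) < r" by blast
    obtain x where x: "x \<in> F i - F j" "has_nonedge (F i - {x})"
      using has_nonedge_transfer[of "F i" "F j"] less.prems(1) i j by auto
    define F' where "F' = F(i := F i - {x}, j := insert x (F j))"
    have ij: "i \<noteq> j" using i j by auto
    have F': "F' i = F i - {x}" "F' j = insert x (F j)" using ij by (simp_all add: F'_def)
    have split: "(\<Sum>t<k. h (f t)) = h (f i) + h (f j) + (\<Sum>t\<in>{..<k} - {i, j}. h (f t))"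
      for h :: "'a set \<Rightarrow> 'c::comm_monoid_add" and f :: "nat \<Rightarrow> 'a set"
    proof -
      have "(\<Sum>t<k. h (f t)) = h (f i) + (\<Sum>t\<in>{..<k} - {i}. h (f t))"
        using i(1) by (intro sum.remove) auto
      also have "(\<Sum>t\<in>{..<k} - {i}. h (f t)) = h (f j) + (\<Sum>t\<in>{..<k} - {i} - {j}. h (f t))"
        using j(1) ij by (intro sum.remove) auto
      also have "{..<k} - {i} - {j} = {..<k} - {i, j}" by blast
      finally show ?thesis by (simp only: add.assoc)
    qed
    have rest: "(\<Sum>t\<in>{..<k} - {i, j}. h (F' t)) = (\<Sum>t\<in>{..<k} - {i, j}. h (F t))"
      for h :: "'a set \<Rightarrow> 'c::comm_monoid_add"
      by (rule sum.cong) (auto simp: F'_def)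
    have card': "card (F i) = Suc (card (F' i))" "card (F' j) = Suc (card (F j))"
      using x(1) card.remove[of "F i" x] by (simp_all add: F')
    have "card (F' i) ^ 2 + card (F' j) ^ 2 < card (F i) ^ 2 + card (F j) ^ 2"
      using i(2) j(2) unfolding card' by (simp add: power2_eq_square algebra_simps)
    then have "(\<Sum>t<k. card (F' t) ^ 2) < (\<Sum>t<k. card (F t) ^ 2)"
      using split[of "\<lambda>A. card A ^ 2" F'] split[of "\<lambda>A. card A ^ 2" F] rest[of "\<lambda>A. card A ^ 2"] by simp
    moreover have "has_nonedge (F' t)" if "t < k" for t
      using less.prems(1)[OF that] x(2) has_nonedge_mono[of "F j" "insert x (F j)"] by (auto simp: F'_def)
    moreover have "(\<Sum>t<k. card (F' t)) = r * k"
      using split[of card F'] split[of card F] rest[of card] card' less.prems(2) by simp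
    moreover have "(\<Sum>t<k. set_mon (F' t)) = (\<Sum>t<k. set_mon (F t))"
      unfolding split[of set_mon F'] split[of set_mon F] rest[of set_mon] F'
      using x(1) set_mon_remove[of x "F i"] set_mon_insert[of x "F j"] by (simp add: ac_simps)
    ultimately show ?thesis using less.hyps[of F'] by simp
  qed
qed

text \<open>One non-edge from each set gives a factor. Conversely, the \<open>k\<close> pairs of a
  factor serve as initial sets, over which the remaining variables are distributed before sizes are
  balanced.\<close>

lemma nonedge_set_products:
  "{\<Sum>i<k. set_mon (F i) | F. \<forall>i<k. F i \<in> {F. card F = r \<and> has_nonedge F}} = bounded_multiples (r * k) k"
  (is "?L = ?R")
proof
  show "?L \<subseteq> ?R"
  proof
    fix m assume "m \<in> ?L"
    then obtain F where m: "m = (\<Sum>i<k. set_mon (F i))"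
      and F: "\<And>i. i < k \<Longrightarrow> card (F i) = r" "\<And>i. i < k \<Longrightarrow> has_nonedge (F i)" by blast
    have "\<exists>e. e \<in> N \<and> fst e \<in> F i \<and> snd e \<in> F i" if "i < k" for i
      using F(2)[OF that] by (auto simp: has_nonedge_def)
    then obtain e where e: "\<And>i. i < k \<Longrightarrow> e i \<in> N" "\<And>i. i < k \<Longrightarrow> fst (e i) \<in> F i"
      "\<And>i. i < k \<Longrightarrow> snd (e i) \<in> F i" by metis
    define W where "W = image_mset e (mset_set {..<k})"
    have W_mon: "pairs_mon W = (\<Sum>i<k. pair_mon (e i))"
      by (simp add: W_def pairs_mon_def image_mset.compositionality o_def sum_unfold_sum_mset)
    have "set_mon (F i) = pair_mon (e i) + set_mon (F i - {fst (e i)} - {snd (e i)})" if "i < k" for i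
    proof -
      have "fst (e i) \<noteq> snd (e i)"
        using rank_less[of "fst (e i)" "snd (e i)"] e(1)[OF that] by auto
      then show ?thesis
        using set_mon_remove[OF e(2)[OF that]] set_mon_remove[of "snd (e i)" "F i - {fst (e i)}"] e(3)[OF that]
        by (simp add: pair_mon_def add.assoc)
    qed
    then have "m = pairs_mon W + (\<Sum>i<k. set_mon (F i - {fst (e i)} - {snd (e i)}))"
      by (simp add: m W_mon flip: sum.distrib)
    then have "pair_factor k m W"
      using e(1) by (auto simp: pair_factor_def W_def)
    moreover have "mon_deg m = r * k"
      by (simp add: m mon_deg_sum mon_deg_set_mon F(1))
    moreover have "Poly_Mapping.lookup m x \<le> k" for x
    proof -
      have "Poly_Mapping.lookup m x \<le> (\<Sum>i<k. 1)"
        unfolding m lookup_sum by (rule sum_mono) (simp add: lookup_set_mon)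
      then show ?thesis by simp
    qed
    ultimately show "m \<in> ?R" by (auto simp: bounded_multiples_def)
  qed
  show "?R \<subseteq> ?L"
  proof
    fix m assume "m \<in> ?R"
    then obtain W where deg: "mon_deg m = r * k" and bound: "\<And>x. Poly_Mapping.lookup m x \<le> k"
      and W: "pair_factor k m W" by (auto simp: bounded_multiples_def)
    obtain w where w: "m = pairs_mon W + w" using W by (auto simp: pair_factor_def)
    obtain es where es: "mset es = W" using ex_mset by blast
    have len: "length es = k" using W es by (auto simp: pair_factor_def)
    have esN: "es ! i \<in> N" if "i < k" for i
      using W es nth_mem[of i es] that len by (auto simp: pair_factor_def)
    define F where "F i = {fst (es ! i), snd (es ! i)}" for i
    have F: "has_nonedge (F i)" if "i < k" for i
      using esN[OF that] by (auto simp: has_nonedge_def F_def) (metis prod.collapse)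
    have "set_mon (F i) = pair_mon (es ! i)" if "i < k" for i
    proof -
      have "fst (es ! i) \<noteq> snd (es ! i)"
        using rank_less[of "fst (es ! i)" "snd (es ! i)"] esN[OF that] by auto
      then show ?thesis by (simp add: set_mon_def F_def pair_mon_def)
    qed
    then have "(\<Sum>i<k. set_mon (F i)) = (\<Sum>i<k. pair_mon (es ! i))" by simp
    also have "\<dots> = pairs_mon W"
      unfolding pairs_mon_def es[symmetric]
      by (simp add: len[symmetric] sum_mset_sum_list sum_list_sum_nth atLeast0LessThan flip: mset_map)
    finally have sumF: "(\<Sum>i<k. set_mon (F i)) = pairs_mon W" .
    obtain G where G: "\<And>i. i < k \<Longrightarrow> has_nonedge (G i)" "(\<Sum>i<k. set_mon (G i)) = m"
      using distribute_monomial[of k F w] F bound by (auto simp: sumF w)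
    have "(\<Sum>i<k. card (G i)) = r * k"
      using deg by (simp add: G(2)[symmetric] mon_deg_sum mon_deg_set_mon)
    then obtain H where "\<forall>i<k. card (H i) = r \<and> has_nonedge (H i)" "(\<Sum>i<k. set_mon (H i)) = m"
      using balance_sets[of k G r] G by auto
    then show "m \<in> ?L" by blast
  qed
qed

end

section \<open>Quasi-trees\<close>

lemma quasi_tree_perfect_elimination:
  fixes \<Delta> :: "'a::finite set set"
  assumes sc: "simplicial_complex \<Delta>" and qt: "quasi_tree \<Delta>"
  shows "\<exists>rank N. perfect_elimination rank N \<and>
    (\<forall>F. F \<noteq> {} \<longrightarrow> (F \<notin> \<Delta> \<longleftrightarrow> perfect_elimination.has_nonedge N F))"
proof -
  obtain L where L: "distinct L" "set L = facets \<Delta>"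
    and leaf: "\<And>i. i < length L \<Longrightarrow> is_leaf (generated (set (take (Suc i) L))) (L ! i)"
    using qt unfolding quasi_tree_def by blast
  have down: "G \<in> \<Delta>" if "F \<in> \<Delta>" "G \<subseteq> F" for F G
    using sc that unfolding simplicial_complex_def by blast
  have L_face: "L ! i \<in> \<Delta>" if "i < length L" for i
    using that L(2) nth_mem[of i L] by (auto simp: facets_def)
  have cover: "\<exists>i<length L. G \<subseteq> L ! i" if "G \<in> \<Delta>" for G
  proof -
    have "\<exists>F\<in>\<Delta>. G \<subseteq> F \<and> (\<forall>H\<in>\<Delta>. F \<subseteq> H \<longrightarrow> F = H)"
      using that by (intro finite_has_maximal2) simp_all
    then obtain F where F: "F \<in> \<Delta>" "G \<subseteq> F" "\<forall>H\<in>\<Delta>. F \<subseteq> H \<longrightarrow> F = H" by blast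
    then have "F \<in> set L" unfolding L(2) facets_def by auto
    then show ?thesis using F(2) by (auto simp: in_set_conv_nth)
  qed
  \<comment> \<open>Facets form an antichain, so each prefix of \<open>L\<close> is the facet set of
    what it generates; the leaf condition thus speaks about list entries.\<close>
  have facets_take: "facets (generated (set (take n L))) = set (take n L)" for n
  proof -
    have anti: "F = G" if "F \<in> set (take n L)" "G \<in> set (take n L)" "F \<subseteq> G" for F G
      using that set_take_subset[of n L] L(2) unfolding facets_def by blast
    show ?thesis
    proof
      show "facets (generated (set (take n L))) \<subseteq> set (take n L)"
        unfolding facets_def generated_def by blast
      show "set (take n L) \<subseteq> facets (generated (set (take n L)))"
        using anti unfolding facets_def generated_def by blast
    qed
  qed
  define s where "s x = (LEAST i. i < length L \<and> x \<in> L ! i)" for x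
  have s: "s x < length L \<and> x \<in> L ! s x" for x
  proof -
    have "{x} \<in> \<Delta>" using sc by (simp add: simplicial_complex_def)
    then have "\<exists>i. i < length L \<and> x \<in> L ! i" using cover[of "{x}"] by auto
    then show ?thesis unfolding s_def by (rule LeastI_ex)
  qed
  have s_le: "s x \<le> i" if "i < length L" "x \<in> L ! i" for x i
    unfolding s_def using that by (intro Least_le) simp
  have adjacent: "y \<in> L ! s x" if xy: "{x, y} \<in> \<Delta>" "s y \<le> s x" for x y
  proof -
    \<comment> \<open>In the first facet containing both vertices, suppose each had occurred
      earlier. The facet witnessing the leaf condition contains the intersections with all earlier
      facets, hence both vertices, contradicting the choice of \<open>j\<close>.\<close>
    define j where "j = (LEAST j. j < length L \<and> x \<in> L ! j \<and> y \<in> L ! j)"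
    have "\<exists>j. j < length L \<and> x \<in> L ! j \<and> y \<in> L ! j" using cover[OF xy(1)] by auto
    then have j: "j < length L" "x \<in> L ! j" "y \<in> L ! j"
      unfolding j_def by (metis (mono_tags, lifting) LeastI_ex)+
    have j_least: "j \<le> p" if "p < length L" "x \<in> L ! p" "y \<in> L ! p" for p
      unfolding j_def using that by (intro Least_le) simp
    have "j = s x"
    proof (rule ccontr)
      assume "j \<noteq> s x"
      then have less: "s x < j" "s y < j" using s_le[OF j(1,2)] xy(2) by auto
      have in_take: "L ! t \<in> set (take (Suc j) L) \<and> L ! t \<noteq> L ! j" if "t < j" for t
        using that j(1) L(1) by (auto simp: in_set_conv_nth nth_eq_iff_index_eq intro!: exI[of _ t])
      have "facets (generated (set (take (Suc j) L))) \<noteq> {L ! j}"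
        unfolding facets_take using in_take[OF less(1)] by auto
      then obtain G where G: "G \<in> set (take (Suc j) L)" "G \<noteq> L ! j"
        "\<And>H. H \<in> set (take (Suc j) L) \<Longrightarrow> H \<noteq> L ! j \<Longrightarrow> H \<inter> L ! j \<subseteq> G \<inter> L ! j"
        using leaf[OF j(1)] unfolding is_leaf_def facets_take by blast
      obtain p where p: "p < Suc j" "G = L ! p"
        using G(1) j(1) by (auto simp: in_set_conv_nth)
      have "p < j" using p G(2) by (cases "p = j") auto
      moreover have "x \<in> L ! p" "y \<in> L ! p"
        using G(3)[of "L ! s x"] G(3)[of "L ! s y"] in_take[OF less(1)] in_take[OF less(2)] s j(2,3) p(2) by blast+
      ultimately show False using j_least[of p] j(1) by simp
    qed
    then show ?thesis using j(3) by simp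
  qed
  obtain f :: "'a \<Rightarrow> nat" and n where f: "range f = {i. i < n}" "inj f"
    using finite_imp_inj_to_nat_seg[of "UNIV :: 'a set"] by auto
  have fn: "f x < n" for x using f(1) by auto
  \<comment> \<open>Vertices appearing late are eliminated early; \<open>f x < n\<close> breaks ties
    without disturbing the comparison of \<open>s\<close>.\<close>
  define rank where "rank x = (length L - s x) * n + f x" for x
  have rank_mod: "rank x mod n = f x" for x using fn[of x] by (simp add: rank_def)
  have rank_s: "s y \<le> s x" if "rank x < rank y" for x y
  proof (rule ccontr)
    assume "\<not> s y \<le> s x"
    then have "Suc (length L - s y) \<le> length L - s x" using s[of y] by arith
    then have "Suc (length L - s y) * n \<le> (length L - s x) * n" by (rule mult_le_mono1)
    then have "rank y < rank x" using fn[of y] by (simp add: rank_def)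
    then show False using that by simp
  qed
  define N where "N = {(x, y). rank x < rank y \<and> {x, y} \<notin> \<Delta>}"
  have pe: "perfect_elimination rank N"
  proof
    show "inj rank"
      using f(2) by (auto intro!: injI dest!: arg_cong[of "rank _" "rank _" "\<lambda>r. r mod n"] simp: rank_mod inj_eq)
    show "rank x < rank y" if "(x, y) \<in> N" for x y using that by (simp add: N_def)
    show "(z, x) \<in> N \<or> (z, y) \<in> N" if xy: "(x, y) \<in> N" and z: "rank z < rank x" for x y z
    proof (rule ccontr)
      assume contra: "\<not> ?thesis"
      have zy: "rank z < rank y" using xy z by (simp add: N_def)
      \<comment> \<open>Later neighbours of \<open>z\<close> all lie in the facet where
        \<open>z\<close> first appears, so they are pairwise adjacent.\<close>
      have "{z, x} \<in> \<Delta>" "{z, y} \<in> \<Delta>" using contra z zy by (auto simp: N_def)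
      then have "x \<in> L ! s z" "y \<in> L ! s z" using adjacent rank_s z zy by blast+
      then have "{x, y} \<in> \<Delta>" using down[OF L_face[of "s z"]] s by simp
      then show False using xy by (simp add: N_def)
    qed
  qed
  interpret perfect_elimination rank N by (rule pe)
  have "F \<notin> \<Delta> \<longleftrightarrow> has_nonedge F" if "F \<noteq> {}" for F
  proof
    assume "has_nonedge F"
    then obtain x y where "(x, y) \<in> N" "{x, y} \<subseteq> F" by (auto simp: has_nonedge_def)
    then show "F \<notin> \<Delta>" using down[of F "{x, y}"] by (auto simp: N_def)
  next
    assume F: "F \<notin> \<Delta>"
    show "has_nonedge F"
    proof (rule ccontr)
      assume no: "\<not> has_nonedge F"
      have edge: "{x, y} \<in> \<Delta>" if "x \<in> F" "y \<in> F" for x y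
      proof -
        consider "rank x < rank y" | "rank y < rank x" | "x = y"
          using inj_rank by (metis injD linorder_neqE_nat)
        then show ?thesis
        proof cases
          case 1
          moreover have "(x, y) \<notin> N" using no that unfolding has_nonedge_def by blast
          ultimately show ?thesis by (simp add: N_def)
        next
          case 2
          moreover have "(y, x) \<notin> N" using no that unfolding has_nonedge_def by blast
          ultimately show ?thesis by (simp add: N_def insert_commute)
        next
          case 3
          then show ?thesis using sc by (simp add: simplicial_complex_def)
        qed
      qed
      \<comment> \<open>A clique lies in the first facet of whichever of its vertices appears last,
        so it is a face.\<close>
      have "Max (s ` F) \<in> s ` F" using that by (intro Max_in) auto
      then obtain x where x: "x \<in> F" "s x = Max (s ` F)" by auto
      have "F \<subseteq> L ! s x"
      proof
        fix y assume "y \<in> F"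
        then show "y \<in> L ! s x" using edge x by (intro adjacent) auto
      qed
      then show False using F down[OF L_face[of "s x"]] s by blast
    qed
  qed
  then show ?thesis using pe by blast
qed

theorem theorem4p2:
  fixes \<Delta> :: "('a::finite) set set" and d l k :: nat
  assumes "simplicial_complex \<Delta>"
    and "quasi_tree \<Delta>"
    and "\<exists>F\<in>\<Delta>. card F = d" and "\<forall>F\<in>\<Delta>. card F \<le> d"
    and "l \<le> d - 1"
    and "k \<ge> 1"
  shows "has_linear_resolution
           (ideal_pow (ideal_gen {xmon F :: ('a, 'k::field) mpoly | F. card F = l + 1 \<and> F \<notin> \<Delta>}) k)"
proof -
  obtain rank N where "perfect_elimination rank N"
    and face: "\<And>F. F \<noteq> {} \<Longrightarrow> F \<notin> \<Delta> \<longleftrightarrow> perfect_elimination.has_nonedge N F"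
    using quasi_tree_perfect_elimination[OF assms(1,2)] by blast
  then interpret perfect_elimination rank N by simp
  \<comment> \<open>Sets with \<open>l + 1\<close> elements are nonempty, so non-faces among them
    are exactly those with a non-edge.\<close>
  have "card F = l + 1 \<and> F \<notin> \<Delta> \<longleftrightarrow> F \<in> {F. card F = l + 1 \<and> has_nonedge F}" for F
    using face[of F] by (cases "F = {}") auto
  then have "ideal_pow (ideal_gen {xmon F :: ('a, 'k) mpoly | F. card F = l + 1 \<and> F \<notin> \<Delta>}) k =
      ideal_gen ((\<lambda>m. Poly_Mapping.single m 1) ` bounded_multiples ((l + 1) * k) k)"
    by (simp only: ideal_pow_xmon nonedge_set_products)
  moreover have "linear_resolution
      (ideal_gen ((\<lambda>m. Poly_Mapping.single m (1::'k)) ` bounded_multiples ((l + 1) * k) k)) ((l + 1) * k)"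
  proof (rule monomial_ideal_linear_resolution[where key = "key k"])
    show "finite (bounded_multiples ((l + 1) * k) k)" by (rule finite_bounded_multiples)
    show "mon_deg m = (l + 1) * k" if "m \<in> bounded_multiples ((l + 1) * k) k" for m
      using that by (simp add: bounded_multiples_def)
  qed (rule key_exchange)
  ultimately show ?thesis
    unfolding has_linear_resolution_def by auto
qed

end
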